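(* Let $A\in\mathbb{R}^{n\times n}$, $B\in\mathbb{R}^{n\times m}$, $C\in\mathbb{R}^{p\times n}$ and consider the system $(\star)$: $x_{t+1}=Ax_t+Bu_t$, $y_t=Cx_t$. Assume that $(A,B)$ is controllable, that $(A,C)$ and $(A,Q_x^{1/2})$ are observable, where $Q_x=C^\top QC$, and that $N\ge\ell$, where $\ell$ is the observability index of $(\star)$. Let $\xi_t:=[u_{t-N}^\top,\dots,u_{t-1}^\top,y_{t-N}^\top,\dots,y_{t-1}^\top]^\top$, let $M,\Omega,\Gamma,\mathcal{B}_m$ be as in the context, let $M_0\in\mathbb{R}^{n\times(m+p)N}$ be a matrix with $\ker(M_0)=\operatorname{im}\big(\mathcal{R}(\Omega+\Gamma CM,\mathcal{B}_m)\big)$, and let $\mathcal{A}_m:=\Omega+\Gamma C(M+M_0)$. Then: (a) The state of $(\star)$ and the historical input-output trajectory satisfy $x_t=(M+M_0)\xi_t$, where $M_0$ may be nonzero. (b) The system $$\xi_{t+1}=\mathcal{A}_m\xi_t+\mathcal{B}_mu_t,\qquad y_t=C(M+M_0)\xi_t \qquad(\star\star)$$ is consistent with $(\star)$. (c) The controllability matrix $\mathcal{R}(\mathcal{A}_m,\mathcal{B}_m)$ of $(\star\star)$ has rank $mN+n$. System $(\star\star)$ is controllable if and only if $p=1$, or $p>1$ and $pN=n$; otherwise it is uncontrollable.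
   Context: Here $p\le n$, $C$ has full row rank, and $Q\in\mathbb{R}^{p\times p}$ is symmetric positive semidefinite. $(\cdot)^\dagger$ is the Moore-Penrose pseudo-inverse. The observability index $\ell$ is the smallest positive integer $N$ with $\operatorname{rank}\mathcal{O}_N(A,C)=n$. Notation: $\mathcal{R}_N(A,B):=[A^{N-1}B,\dots,AB,B]$; $\mathcal{O}_N(A,C):=[C^\top,(CA)^\top,\dots,(CA^{N-1})^\top]^\top$; $\mathcal{T}_N(A,B,C)$ is the $pN\times mN$ block matrix whose $(i,j)$ block is $CA^{i-j-1}B$ for $i>j$ and $\mathbf 0$ otherwise. For the pairs with state dimension $d=(m+p)N$, $\mathcal{R}(\mathcal{A},\mathcal{B})$ denotes the controllability matrix $[\mathcal{A}^{d-1}\mathcal{B},\dots,\mathcal{A}\mathcal{B},\mathcal{B}]$. $M:=[\mathcal{R}_N(A,B)-A^N\mathcal{O}_N(A,C)^\dagger\mathcal{T}_N(A,B,C),\;A^N\mathcal{O}_N(A,C)^\dagger]$. $\mathcal{B}_m:=[\mathbf{0}_{m\times m(N-1)},I_m,\mathbf{0}_{m\times pN}]^\top$, $\Gamma:=[\mathbf{0}_{p\times(mN+p(N-1))},I_p]^\top$, and $\Omega:=\operatorname{diag}(\Omega_m,\Omega_p)$, where for $k\in\{m,p\}$, $\Omega_k\in\mathbb{R}^{kN\times kN}$ is the block shift $\begin{bmatrix}\mathbf 0_{k(N-1)\times k}&I_{k(N-1)}\\ \mathbf 0_{k\times k}&\mathbf 0_{k\times k(N-1)}\end{bmatrix}$.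 Consistency: a system $v_{t+1}=\mathcal{A}v_t+\mathcal{B}u_t$, $y_t=\mathcal{C}v_t$ is consistent with $(\star)$ if for any input $\{u_t\}$ there exists a state trajectory $\{v_t\}$ such that the corresponding input-output trajectory $\{u_t,y_t\}$ generated by this system is identical to that generated by $(\star)$.
   Formalization: In (c) the case p=1 is corrected to "p=1 and N=ℓ": for p=1 and N>ℓ=n the rank mN+n is less than the dimension (m+1)N, so the system is uncontrollable (e.g. n=m=p=1, N=2, A=0, B=C=Q=1, M_0=[1,0,0,-1]). *)

theory Defs
  imports
    "Jordan_Normal_Form.DL_Rank"
    "Jordan_Normal_Form.Matrix_Kernel"
    Complex_Main
begin

abbreviation mat_rank :: "real mat \<Rightarrow> nat" where
  "mat_rank A \<equiv> vec_space.rank (dim_row A) A"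

abbreviation mat_image :: "real mat \<Rightarrow> real vec set" where
  "mat_image A \<equiv> vec_space.col_space (dim_row A) A"

definition append_cols :: "real mat \<Rightarrow> real mat \<Rightarrow> real mat" (infixr \<open>@\<^sub>c\<close> 65) where
  "A @\<^sub>c B = four_block_mat A B (0\<^sub>m 0 (dim_col A)) (0\<^sub>m 0 (dim_col B))"

definition psd_mat :: "real mat \<Rightarrow> bool" where
  "psd_mat Q \<longleftrightarrow> square_mat Q \<and> transpose_mat Q = Q \<and>
     (\<forall>v \<in> carrier_vec (dim_row Q). 0 \<le> v \<bullet> (Q *\<^sub>v v))"

definition psd_sqrt :: "real mat \<Rightarrow> real mat" where
  "psd_sqrt Q = (THE S. psd_mat S \<and> S * S = Q)"

definition penrose :: "real mat \<Rightarrow> real mat \<Rightarrow> bool" where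
  "penrose A X \<longleftrightarrow> X \<in> carrier_mat (dim_col A) (dim_row A) \<and>
     A * X * A = A \<and> X * A * X = X \<and>
     transpose_mat (A * X) = A * X \<and> transpose_mat (X * A) = X * A"

definition pinv :: "real mat \<Rightarrow> real mat" where
  "pinv A = (THE X. penrose A X)"

text \<open>Block \<open>(i, j)\<close> of a matrix with blocks of size \<open>a \<times> b\<close> occupies the entries
  \<open>(r, c)\<close> with \<open>r div a = i\<close> and \<open>c div b = j\<close>; block indices start at 0.\<close>

definition ctrb :: "nat \<Rightarrow> real mat \<Rightarrow> real mat \<Rightarrow> real mat" where
  "ctrb N A B = (let m = dim_col B in
     mat (dim_row A) (m * N) (\<lambda>(r, c). (A ^\<^sub>m (N - 1 - c div m) * B) $$ (r, c mod m)))"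

definition obsv :: "nat \<Rightarrow> real mat \<Rightarrow> real mat \<Rightarrow> real mat" where
  "obsv N A C = (let p = dim_row C in
     mat (p * N) (dim_row A) (\<lambda>(r, c). (C * A ^\<^sub>m (r div p)) $$ (r mod p, c)))"

definition toep :: "nat \<Rightarrow> real mat \<Rightarrow> real mat \<Rightarrow> real mat \<Rightarrow> real mat" where
  "toep N A B C = (let m = dim_col B; p = dim_row C in
     mat (p * N) (m * N) (\<lambda>(r, c).
       let i = r div p; j = c div m in
       if j < i then (C * A ^\<^sub>m (i - j - 1) * B) $$ (r mod p, c mod m) else 0))"

definition ctrb_mat :: "real mat \<Rightarrow> real mat \<Rightarrow> real mat" where
  "ctrb_mat A B = ctrb (dim_row A) A B"

definition controllable :: "real mat \<Rightarrow> real mat \<Rightarrow> bool" where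
  "controllable A B \<longleftrightarrow> mat_rank (ctrb_mat A B) = dim_row A"

definition observable :: "real mat \<Rightarrow> real mat \<Rightarrow> bool" where
  "observable A C \<longleftrightarrow> mat_rank (obsv (dim_row A) A C) = dim_row A"

definition obsv_index :: "real mat \<Rightarrow> real mat \<Rightarrow> nat" where
  "obsv_index A C = (LEAST N. 0 < N \<and> mat_rank (obsv N A C) = dim_row A)"

definition M_mat :: "nat \<Rightarrow> real mat \<Rightarrow> real mat \<Rightarrow> real mat \<Rightarrow> real mat" where
  "M_mat N A B C =
     (ctrb N A B - A ^\<^sub>m N * pinv (obsv N A C) * toep N A B C) @\<^sub>c
     (A ^\<^sub>m N * pinv (obsv N A C))"

definition Bm_mat :: "nat \<Rightarrow> nat \<Rightarrow> nat \<Rightarrow> real mat" where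
  "Bm_mat m p N = transpose_mat (0\<^sub>m m (m * (N - 1)) @\<^sub>c 1\<^sub>m m @\<^sub>c 0\<^sub>m m (p * N))"

definition Gamma_mat :: "nat \<Rightarrow> nat \<Rightarrow> nat \<Rightarrow> real mat" where
  "Gamma_mat m p N = transpose_mat (0\<^sub>m p (m * N + p * (N - 1)) @\<^sub>c 1\<^sub>m p)"

definition block_shift :: "nat \<Rightarrow> nat \<Rightarrow> real mat" where
  "block_shift k N = four_block_mat
     (0\<^sub>m (k * (N - 1)) k) (1\<^sub>m (k * (N - 1)))
     (0\<^sub>m k k)             (0\<^sub>m k (k * (N - 1)))"

definition Omega_mat :: "nat \<Rightarrow> nat \<Rightarrow> nat \<Rightarrow> real mat" where
  "Omega_mat m p N = diag_block_mat [block_shift m N, block_shift p N]"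

definition Am_mat :: "nat \<Rightarrow> real mat \<Rightarrow> real mat \<Rightarrow> real mat \<Rightarrow> real mat \<Rightarrow> real mat" where
  "Am_mat N A B C M0 = (let m = dim_col B; p = dim_row C in
     Omega_mat m p N + Gamma_mat m p N * C * (M_mat N A B C + M0))"

definition trajectory :: "real mat \<Rightarrow> real mat \<Rightarrow> real mat \<Rightarrow>
    (nat \<Rightarrow> real vec) \<Rightarrow> (nat \<Rightarrow> real vec) \<Rightarrow> (nat \<Rightarrow> real vec) \<Rightarrow> bool" where
  "trajectory A B C u x y \<longleftrightarrow>
     (\<forall>t. u t \<in> carrier_vec (dim_col B) \<and> x t \<in> carrier_vec (dim_row A) \<and>
          x (Suc t) = A *\<^sub>v x t + B *\<^sub>v u t \<and> y t = C *\<^sub>v x t)"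

text \<open>The initial state of the reference system \<open>(A, B, C)\<close> is arbitrary, so the
  input-output trajectories it generates are all pairs \<open>(u, y)\<close> admitting a state trajectory.\<close>

definition consistent_with ::
    "real mat \<Rightarrow> real mat \<Rightarrow> real mat \<Rightarrow> real mat \<Rightarrow> real mat \<Rightarrow> real mat \<Rightarrow> bool" where
  "consistent_with A' B' C' A B C \<longleftrightarrow>
     (\<forall>u x y. trajectory A B C u x y \<longrightarrow> (\<exists>v. trajectory A' B' C' u v y))"

text \<open>\<open>[w (t - N); \<dots>; w (t - 1)]\<close> stacked into one vector; meaningful for \<open>N \<le> t\<close>.\<close>

definition stack_past :: "nat \<Rightarrow> nat \<Rightarrow> (nat \<Rightarrow> real vec) \<Rightarrow> nat \<Rightarrow> real vec" where
  "stack_past k N w t = vec (k * N) (\<lambda>i. w (t - N + i div k) $ (i mod k))"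

definition xi :: "nat \<Rightarrow> nat \<Rightarrow> nat \<Rightarrow> (nat \<Rightarrow> real vec) \<Rightarrow> (nat \<Rightarrow> real vec) \<Rightarrow> nat \<Rightarrow> real vec" where
  "xi m p N u y t = stack_past m N u t @\<^sub>v stack_past p N y t"

definition io_setting :: "nat \<Rightarrow> nat \<Rightarrow> nat \<Rightarrow> nat \<Rightarrow>
    real mat \<Rightarrow> real mat \<Rightarrow> real mat \<Rightarrow> real mat \<Rightarrow> real mat \<Rightarrow> bool" where
  "io_setting n m p N A B C Q M0 \<longleftrightarrow>
     0 < n \<and> 0 < m \<and> 0 < p \<and> p \<le> n \<and>
     A \<in> carrier_mat n n \<and> B \<in> carrier_mat n m \<and> C \<in> carrier_mat p n \<and>
     mat_rank C = p \<and>
     Q \<in> carrier_mat p p \<and> psd_mat Q \<and>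
     controllable A B \<and> observable A C \<and>
     observable A (psd_sqrt (transpose_mat C * Q * C)) \<and>
     obsv_index A C \<le> N \<and>
     M0 \<in> carrier_mat n ((m + p) * N) \<and>
     mat_kernel M0 =
       mat_image (ctrb_mat (Omega_mat m p N + Gamma_mat m p N * C * M_mat N A B C) (Bm_mat m p N))"

end

theory Submission
  imports Defs
begin

text \<open>Call the vectors \<open>[U; O\<^sub>N x + T\<^sub>N U]\<close> the input-output windows of \<open>(A, B, C)\<close>; as \<open>O\<^sub>N\<close> is
  injective they form a space of dimension \<open>mN + n\<close>. If \<open>K\<close> recovers the current state from
  every window, then \<open>\<Omega> + \<Gamma> C K\<close> and \<open>B\<^sub>m\<close> merely slide the window along a trajectory, so the states
  which the lifted system reaches from zero are windows, and by controllability of \<open>(A, B)\<close> all of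
  them. The matrix \<open>M\<close> recovers the state because the pseudo-inverse is a left inverse of \<open>O\<^sub>N\<close>; hence
  \<open>M\<^sub>0\<close> vanishes exactly on the windows and \<open>M + M\<^sub>0\<close> recovers the state as well.\<close>

section \<open>Rank and image\<close>

text \<open>The image of the controllability matrix depends on \<open>K\<close> only through the
  recovery property \<open>reads_state\<close>, so one image theorem is applied twice: with
  \<open>K = M\<close> it identifies the kernel of \<open>M0\<close>, with \<open>K = M + M0\<close>
  it yields the rank in (c), and no matrix identity involving \<open>M0\<close> is ever computed.
  Two obstacles shape the details. A full window exists only from time \<open>N\<close> on, so the
  lifted clock starts at original time \<open>N\<close>, and the zero lifted state is realised by a
  system at rest for \<open>N\<close> steps. Consistency, however, concerns trajectories that start
  at time 0 without a past; since \<open>A\<close> may be singular, a past cannot be produced by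
  inverting the dynamics and is obtained from controllability instead. The lifted dimension is
  \<open>m * N + p * N\<close>, hence controllability amounts to \<open>p * N = n\<close>, and this
  is also exactly the case in which the windows fill the space and force \<open>M0\<close> to
  vanish.\<close>

lemma mat_image_eq:
  assumes "A \<in> carrier_mat r c"
  shows "mat_image A = (\<lambda>v. A *\<^sub>v v) ` carrier_vec c"
  using assms vec_space.col_space_eq[of A r c] by auto

text \<open>Rank is the dimension of the column span. The two matrices may have different numbers of
  columns, so the rank of a controllability matrix can be read off from a slimmer matrix.\<close>

lemma mat_rank_eqI_image:
  assumes "A \<in> carrier_mat r c" "B \<in> carrier_mat r d" "mat_image A = mat_image B"
  shows "mat_rank A = mat_rank B"
  using assms unfolding vec_space.rank_def vec_space.col_space_def by auto

text \<open>Linear independence speaks of the set of columns, which forgets repetitions, so each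
  direction first shows that the columns are distinct: by counting a maximal independent subset, or
  because two equal columns put a difference of unit vectors into the kernel.\<close>

lemma mat_rank_eq_dim_col_iff:
  assumes A: "A \<in> carrier_mat r c"
  shows "mat_rank A = c \<longleftrightarrow> (\<forall>v \<in> carrier_vec c. A *\<^sub>v v = 0\<^sub>v r \<longrightarrow> v = 0\<^sub>v c)"
proof -
  interpret vec_space "TYPE(real)" r .
  have dr: "dim_row A = r" using A by auto
  have dist1: "distinct (cols A)" if "rank A = c"
  proof -
    obtain S where S: "maximal S (\<lambda>T. T \<subseteq> set (cols A) \<and> lin_indpt T)"
      using maximal_exists_superset[of "set (cols A)" "\<lambda>T. T \<subseteq> set (cols A) \<and> lin_indpt T" "{}"]
      by (auto simp: lin_dep_def)
    have "card S = c" using rank_card_indpt[OF A S] that by simp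
    moreover have "card S \<le> card (set (cols A))"
      using S by (intro card_mono) (auto simp: maximal_def)
    moreover have "length (cols A) = c" using A by simp
    ultimately show ?thesis using card_distinct card_length by (metis le_antisym)
  qed
  have dist2: "distinct (cols A)" if inj: "\<forall>v \<in> carrier_vec c. A *\<^sub>v v = 0\<^sub>v r \<longrightarrow> v = 0\<^sub>v c"
  proof (rule ccontr)
    assume "\<not> distinct (cols A)"
    then obtain i j where ij: "i < c" "j < c" "i \<noteq> j" "col A i = col A j"
      using A by (auto simp: distinct_conv_nth)
    let ?v = "unit_vec c i - unit_vec c j :: real vec"
    have "A *\<^sub>v ?v = A *\<^sub>v unit_vec c i - A *\<^sub>v unit_vec c j"
      by (rule mult_minus_distrib_mat_vec[OF A]) auto
    also have "\<dots> = 0\<^sub>v r" using A ij by (intro eq_vecI) (auto simp: col_def vec_eq_iff)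
    finally have "A *\<^sub>v ?v = 0\<^sub>v r" .
    hence "?v = 0\<^sub>v c" using inj[rule_format, of ?v] by simp
    hence "?v $ i = 0" using ij by simp
    thus False using ij by simp
  qed
  show ?thesis unfolding dr
  proof
    assume rk: "rank A = c"
    show "\<forall>v \<in> carrier_vec c. A *\<^sub>v v = 0\<^sub>v r \<longrightarrow> v = 0\<^sub>v c"
      using lin_depI[OF A _ _ _ dist1[OF rk]] full_rank_lin_indpt[OF A rk dist1[OF rk]] by blast
  next
    assume inj: "\<forall>v \<in> carrier_vec c. A *\<^sub>v v = 0\<^sub>v r \<longrightarrow> v = 0\<^sub>v c"
    show "rank A = c"
      using lin_indpt_full_rank[OF A dist2[OF inj]] lin_depE[OF A _ dist2[OF inj]] inj by blast
  qed
qed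

lemma mat_rank_le_dim_row: "mat_rank A \<le> dim_row A"
proof -
  interpret vec_space "TYPE(real)" "dim_row A" .
  obtain S where S: "maximal S (\<lambda>T. T \<subseteq> set (cols A) \<and> lin_indpt T)"
    using maximal_exists_superset[of "set (cols A)" "\<lambda>T. T \<subseteq> set (cols A) \<and> lin_indpt T" "{}"]
    by (auto simp: lin_dep_def)
  have "rank A = card S" by (rule rank_card_indpt[OF _ S]) auto
  moreover have "S \<subseteq> set (cols A)" "lin_indpt S" using S by (simp_all add: maximal_def)
  moreover from this have "S \<subseteq> carrier_vec (dim_row A)" using cols_dim[of A] by blast
  ultimately show ?thesis using li_le_dim(2)[OF fin_dim, of S] dim_is_n by simp
qed

text \<open>A maximal independent set of columns has \<open>r\<close> elements and is therefore a
  basis of the whole space.\<close>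

lemma full_row_rank_image:
  assumes A: "A \<in> carrier_mat r c" and rk: "mat_rank A = r"
  shows "mat_image A = carrier_vec r"
proof -
  interpret vec_space "TYPE(real)" r .
  have dr: "dim_row A = r" using A by auto
  obtain S where S: "maximal S (\<lambda>T. T \<subseteq> set (cols A) \<and> lin_indpt T)" "finite S"
    using maximal_exists_superset[of "set (cols A)" "\<lambda>T. T \<subseteq> set (cols A) \<and> lin_indpt T" "{}"]
    by (auto simp: lin_dep_def)
  have SA: "S \<subseteq> set (cols A)" and li: "lin_indpt S" using S by (auto simp: maximal_def)
  have Sc: "S \<subseteq> carrier_vec r" using SA cols_dim[of A] dr by auto
  have "card S = r" using rank_card_indpt[OF A S(1)] rk dr by simp
  hence "basis S" using dim_li_is_basis[OF fin_dim S(2)] Sc li dim_is_n by auto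
  hence "span S = carrier_vec r" by (auto simp: basis_def)
  moreover have "span S \<subseteq> span (set (cols A))" by (rule span_is_monotone[OF SA])
  moreover have "span (set (cols A)) \<subseteq> carrier_vec r"
    using mat_image_eq[OF A] A unfolding dr col_space_def by auto
  ultimately show ?thesis unfolding dr col_space_def by auto
qed

section \<open>Response of a linear system over a finite horizon\<close>

lemma mult_mat_vec_in_carrier: "A \<in> carrier_mat r c \<Longrightarrow> A *\<^sub>v v \<in> carrier_vec r"
  by (auto intro: carrier_vecI)

lemma mult_mat_vec_zero: "A \<in> carrier_mat r c \<Longrightarrow> A *\<^sub>v 0\<^sub>v c = 0\<^sub>v r"
  by (intro eq_vecI) auto

lemma append_cols_mult_vec:
  assumes "P \<in> carrier_mat r c" "Q \<in> carrier_mat r d" "a \<in> carrier_vec c" "b \<in> carrier_vec d"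
  shows "(P @\<^sub>c Q) *\<^sub>v (a @\<^sub>v b) = P *\<^sub>v a + Q *\<^sub>v b"
proof -
  have "(P @\<^sub>c Q) *\<^sub>v (a @\<^sub>v b)
      = (P *\<^sub>v a + Q *\<^sub>v b) @\<^sub>v (0\<^sub>m 0 c *\<^sub>v a + 0\<^sub>m 0 d *\<^sub>v b)"
    unfolding append_cols_def
    using four_block_mat_mult_vec[of P r c Q d "0\<^sub>m 0 c" 0 "0\<^sub>m 0 d" a b] assms by auto
  also have "\<dots> = P *\<^sub>v a + Q *\<^sub>v b" by (intro eq_vecI) auto
  finally show ?thesis .
qed

lemma append_cols_carrier:
  assumes "P \<in> carrier_mat r c" "Q \<in> carrier_mat r d"
  shows "P @\<^sub>c Q \<in> carrier_mat r (c + d)"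
  using assms unfolding append_cols_def by (auto simp: four_block_mat_def Let_def)

lemma pow_mat_Suc_left:
  assumes "A \<in> carrier_mat d d"
  shows "A ^\<^sub>m Suc k = A * A ^\<^sub>m k"
proof (induction k)
  case 0
  then show ?case using assms by simp
next
  case (Suc k)
  have "A ^\<^sub>m Suc (Suc k) = A * A ^\<^sub>m k * A" using Suc by simp
  also have "\<dots> = A * (A ^\<^sub>m k * A)"
    by (rule assoc_mult_mat) (use assms in auto)
  finally show ?case by simp
qed

lemma stack_past_carrier [simp]: "stack_past k N w t \<in> carrier_vec (k * N)"
  by (simp add: stack_past_def)

lemma dim_stack_past [simp]: "dim_vec (stack_past k N w t) = k * N"
  by (simp add: stack_past_def)

text \<open>Writing the time as start plus length makes the truncated subtraction in
  \<open>stack_past\<close> exact: both windows begin at \<open>t\<close>.\<close>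

lemma stack_past_Suc:
  assumes "w (t + N) \<in> carrier_vec k"
  shows "stack_past k (Suc N) w (t + Suc N) = stack_past k N w (t + N) @\<^sub>v w (t + N)"
proof (rule eq_vecI)
  fix i assume i: "i < dim_vec (stack_past k N w (t + N) @\<^sub>v w (t + N))"
  hence ik: "i < k * N + k" using assms by simp
  show "stack_past k (Suc N) w (t + Suc N) $ i = (stack_past k N w (t + N) @\<^sub>v w (t + N)) $ i"
  proof (cases "i < k * N")
    case True
    then show ?thesis using ik assms by (simp add: stack_past_def)
  next
    case False
    then obtain j where j: "i = k * N + j" "j < k" using ik by (metis add_less_cancel_left le_add_diff_inverse not_less)
    then show ?thesis using assms by (simp add: stack_past_def)
  qed
qed (use assms in auto)

text \<open>Every vector is a stacked sequence, so statements about the image of a controllability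
  matrix become statements about trajectories with a chosen input.\<close>

lemma stack_past_surj:
  assumes "v \<in> carrier_vec (k * N)" "N \<le> t"
  obtains w where "\<And>i. w i \<in> carrier_vec k" "stack_past k N w t = v"
proof
  let ?w = "\<lambda>i. vec k (\<lambda>j. v $ (k * (i - (t - N)) + j))"
  show "?w i \<in> carrier_vec k" for i by simp
  show "stack_past k N ?w t = v"
  proof (rule eq_vecI)
    fix i assume "i < dim_vec v"
    hence i: "i < k * N" using assms by simp
    hence "0 < k" by (cases k) auto
    thus "stack_past k N ?w t $ i = v $ i" using i by (simp add: stack_past_def)
  qed (use assms in auto)
qed

lemma ctrb_carrier:
  assumes "A \<in> carrier_mat d d" "B \<in> carrier_mat d m"
  shows "ctrb N A B \<in> carrier_mat d (m * N)"
  using assms by (auto simp: ctrb_def Let_def)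

text \<open>The newest input occupies the last block, as in \<open>stack_past_Suc\<close>; one more
  step multiplies the older blocks by \<open>A\<close>.\<close>

lemma ctrb_Suc:
  assumes A: "A \<in> carrier_mat d d" and B: "B \<in> carrier_mat d m"
  shows "ctrb (Suc N) A B = (A * ctrb N A B) @\<^sub>c B"
proof (rule eq_matI)
  note cc = ctrb_carrier[OF A B]
  have carr: "(A * ctrb N A B) @\<^sub>c B \<in> carrier_mat d (m * N + m)"
    using append_cols_carrier[of "A * ctrb N A B" d "m * N" B m] A B cc[of N] by auto
  fix r c assume "r < dim_row ((A * ctrb N A B) @\<^sub>c B)" "c < dim_col ((A * ctrb N A B) @\<^sub>c B)"
  hence r: "r < d" and c: "c < m * N + m" using carr by auto
  hence m: "0 < m" by (cases m) auto
  show "ctrb (Suc N) A B $$ (r, c) = ((A * ctrb N A B) @\<^sub>c B) $$ (r, c)"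
  proof (cases "c < m * N")
    case True
    let ?j = "c div m"
    have j: "?j < N" using True m by (simp add: less_mult_imp_div_less mult.commute)
    hence "N - ?j = Suc (N - 1 - ?j)" by simp
    hence "A ^\<^sub>m (N - ?j) * B = A * (A ^\<^sub>m (N - 1 - ?j) * B)"
      using pow_mat_Suc_left[OF A] assoc_mult_mat[of A d d "A ^\<^sub>m (N - 1 - ?j)" d B m] A B
      by (simp del: pow_mat.simps)
    hence "ctrb (Suc N) A B $$ (r, c) = (A * (A ^\<^sub>m (N - 1 - ?j) * B)) $$ (r, c mod m)"
      using A B r c by (simp add: ctrb_def Let_def)
    also have "\<dots> = row A r \<bullet> col (A ^\<^sub>m (N - 1 - ?j) * B) (c mod m)"
      using A B r m by simp
    also have "col (A ^\<^sub>m (N - 1 - ?j) * B) (c mod m) = col (ctrb N A B) c"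
      using A B True m by (intro eq_vecI) (auto simp: ctrb_def Let_def)
    also have "row A r \<bullet> col (ctrb N A B) c = (A * ctrb N A B) $$ (r, c)"
      using A r True cc[of N] by simp
    also have "\<dots> = ((A * ctrb N A B) @\<^sub>c B) $$ (r, c)"
      using A B r True cc[of N] by (simp add: append_cols_def)
    finally show ?thesis .
  next
    case False
    then obtain j where j: "c = m * N + j" "j < m"
      using c by (metis add_less_cancel_left le_add_diff_inverse not_less)
    then show ?thesis using A B r cc[of N] m
      by (simp add: append_cols_def) (simp add: ctrb_def Let_def)
  qed
qed (use assms ctrb_carrier[OF A B] in \<open>auto simp: append_cols_def ctrb_def Let_def\<close>)

lemma trajectoryD:
  assumes "trajectory A B C u x y" "A \<in> carrier_mat d d" "B \<in> carrier_mat d m"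
  shows "u t \<in> carrier_vec m" "x t \<in> carrier_vec d"
    "x (Suc t) = A *\<^sub>v x t + B *\<^sub>v u t" "y t = C *\<^sub>v x t"
  using assms unfolding trajectory_def by auto

text \<open>Variation of constants: a further step applies \<open>A\<close> to both terms and adds
  the new input, which \<open>ctrb_Suc\<close> and \<open>stack_past_Suc\<close> reassemble into the
  same shape.\<close>

lemma trajectory_state:
  assumes tr: "trajectory A B C u x y" and A: "A \<in> carrier_mat d d" and B: "B \<in> carrier_mat d m"
  shows "x (t + k) = A ^\<^sub>m k *\<^sub>v x t + ctrb k A B *\<^sub>v stack_past m k u (t + k)"
proof (induction k)
  case 0
  have "ctrb 0 A B *\<^sub>v stack_past m 0 u t = 0\<^sub>v d"
    using ctrb_carrier[OF A B, of 0] by (intro eq_vecI) (auto simp: scalar_prod_def)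
  then show ?case using trajectoryD(2)[OF tr A B, of t] A by simp
next
  case (Suc k)
  note cc = ctrb_carrier[OF A B, of k]
  have xt: "x t \<in> carrier_vec d" and ut: "u (t + k) \<in> carrier_vec m"
    using trajectoryD[OF tr A B] by auto
  have "x (t + Suc k) = A *\<^sub>v (A ^\<^sub>m k *\<^sub>v x t + ctrb k A B *\<^sub>v stack_past m k u (t + k)) + B *\<^sub>v u (t + k)"
    using trajectoryD(3)[OF tr A B, of "t + k"] Suc by simp
  also have "A *\<^sub>v (A ^\<^sub>m k *\<^sub>v x t + ctrb k A B *\<^sub>v stack_past m k u (t + k))
      = A *\<^sub>v (A ^\<^sub>m k *\<^sub>v x t) + A *\<^sub>v (ctrb k A B *\<^sub>v stack_past m k u (t + k))"
    by (rule mult_add_distrib_mat_vec[OF A])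
       (use A xt cc in \<open>auto intro: mult_mat_vec_in_carrier pow_carrier_mat\<close>)
  also have "A *\<^sub>v (A ^\<^sub>m k *\<^sub>v x t) = A ^\<^sub>m Suc k *\<^sub>v x t"
    unfolding pow_mat_Suc_left[OF A] using A xt
    by (intro assoc_mult_mat_vec[symmetric]) auto
  also have "A *\<^sub>v (ctrb k A B *\<^sub>v stack_past m k u (t + k)) = (A * ctrb k A B) *\<^sub>v stack_past m k u (t + k)"
    using A cc by (intro assoc_mult_mat_vec[symmetric]) auto
  also have "A ^\<^sub>m Suc k *\<^sub>v x t + (A * ctrb k A B) *\<^sub>v stack_past m k u (t + k) + B *\<^sub>v u (t + k)
     = A ^\<^sub>m Suc k *\<^sub>v x t + ((A * ctrb k A B) *\<^sub>v stack_past m k u (t + k) + B *\<^sub>v u (t + k))"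
    by (rule assoc_add_vec[of _ d])
       (use A B xt ut cc in \<open>auto intro: mult_mat_vec_in_carrier pow_carrier_mat simp del: pow_mat.simps\<close>)
  also have "(A * ctrb k A B) *\<^sub>v stack_past m k u (t + k) + B *\<^sub>v u (t + k)
     = ctrb (Suc k) A B *\<^sub>v stack_past m (Suc k) u (t + Suc k)"
    unfolding ctrb_Suc[OF A B] stack_past_Suc[of u, OF ut]
    by (rule append_cols_mult_vec[symmetric]) (use A B ut cc in auto)
  finally show ?case .
qed

lemma obsv_carrier:
  assumes "A \<in> carrier_mat n n" "C \<in> carrier_mat p n"
  shows "obsv N A C \<in> carrier_mat (p * N) n"
  using assms by (auto simp: obsv_def Let_def)

lemma toep_carrier:
  assumes "B \<in> carrier_mat n m" "C \<in> carrier_mat p n"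
  shows "toep N A B C \<in> carrier_mat (p * N) (m * N)"
  using assms by (auto simp: toep_def Let_def)

lemma obsv_mult_vec_index:
  assumes "A \<in> carrier_mat n n" "C \<in> carrier_mat p n" "x \<in> carrier_vec n" "r < p * N"
  shows "(obsv N A C *\<^sub>v x) $ r = (C *\<^sub>v (A ^\<^sub>m (r div p) *\<^sub>v x)) $ (r mod p)"
proof -
  have p: "0 < p" using assms by (cases p) auto
  have "row (obsv N A C) r = row (C * A ^\<^sub>m (r div p)) (r mod p)"
    using assms p pow_carrier_mat[OF assms(1), of "r div p"]
    by (intro eq_vecI) (auto simp: obsv_def Let_def row_def simp del: pow_mat_dim)
  hence "(obsv N A C *\<^sub>v x) $ r = ((C * A ^\<^sub>m (r div p)) *\<^sub>v x) $ (r mod p)"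
    using assms p obsv_carrier[of A n C p N] by simp
  also have "(C * A ^\<^sub>m (r div p)) *\<^sub>v x = C *\<^sub>v (A ^\<^sub>m (r div p) *\<^sub>v x)"
    using assms by (intro assoc_mult_mat_vec) auto
  finally show ?thesis .
qed

text \<open>Block row \<open>i\<close> of the Toeplitz matrix is \<open>C * ctrb i A B\<close>
  padded with zeros, because the output at step \<open>i\<close> of a window depends on the first
  \<open>i\<close> inputs only. This reduces the output formula to
  \<open>trajectory_state\<close>.\<close>

lemma toep_index:
  assumes A: "A \<in> carrier_mat n n" and B: "B \<in> carrier_mat n m" and C: "C \<in> carrier_mat p n"
    and r: "r < p * N" and c: "c < m * N"
  shows "toep N A B C $$ (r, c)
    = (if c < m * (r div p) then (C * ctrb (r div p) A B) $$ (r mod p, c) else 0)"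
proof -
  let ?i = "r div p"
  have p: "0 < p" using r by (cases p) auto
  have m: "0 < m" using c by (cases m) auto
  have iff: "c div m < ?i \<longleftrightarrow> c < m * ?i"
    using m by (simp add: div_less_iff_less_mult mult.commute)
  have "(C * A ^\<^sub>m (?i - c div m - 1) * B) $$ (r mod p, c mod m) = (C * ctrb ?i A B) $$ (r mod p, c)"
    if lt: "c < m * ?i"
  proof -
    have "C * A ^\<^sub>m (?i - c div m - 1) * B = C * (A ^\<^sub>m (?i - 1 - c div m) * B)"
      using A B C assoc_mult_mat[of C p n "A ^\<^sub>m (?i - c div m - 1)" n B m] by (simp add: diff_right_commute)
    hence "(C * A ^\<^sub>m (?i - c div m - 1) * B) $$ (r mod p, c mod m)
        = row C (r mod p) \<bullet> col (A ^\<^sub>m (?i - 1 - c div m) * B) (c mod m)"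
      using A B C p m by simp
    also have "col (A ^\<^sub>m (?i - 1 - c div m) * B) (c mod m) = col (ctrb ?i A B) c"
      using A B m lt by (intro eq_vecI) (auto simp: ctrb_def Let_def)
    finally show ?thesis using C p lt ctrb_carrier[OF A B, of ?i] by simp
  qed
  thus ?thesis using A B C r c by (auto simp: toep_def Let_def iff)
qed

lemma toep_mult_stack_past_index:
  assumes A: "A \<in> carrier_mat n n" and B: "B \<in> carrier_mat n m" and C: "C \<in> carrier_mat p n"
    and r: "r < p * N"
  shows "(toep N A B C *\<^sub>v stack_past m N u (t + N)) $ r
    = (C *\<^sub>v (ctrb (r div p) A B *\<^sub>v stack_past m (r div p) u (t + r div p))) $ (r mod p)"
proof -
  let ?i = "r div p"
  have p: "0 < p" using r by (cases p) auto
  have i: "?i < N" using r by (simp add: less_mult_imp_div_less mult.commute)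
  hence le: "m * ?i \<le> m * N" by simp
  note cc = ctrb_carrier[OF A B, of ?i]
  have "(toep N A B C *\<^sub>v stack_past m N u (t + N)) $ r
      = (\<Sum>c = 0..<m * N. toep N A B C $$ (r, c) * stack_past m N u (t + N) $ c)"
    using toep_carrier[OF B C, of N A] r by (simp add: scalar_prod_def)
  \<comment> \<open>Both windows start at \<open>t\<close>, so the shorter one is a prefix of the
    longer one; the columns from \<open>m * ?i\<close> on carry zeros.\<close>
  also have "\<dots> = (\<Sum>c = 0..<m * N. if c < m * ?i
      then (C * ctrb ?i A B) $$ (r mod p, c) * stack_past m ?i u (t + ?i) $ c else 0)"
    by (intro sum.cong) (auto simp: toep_index[OF A B C r] stack_past_def)
  also have "\<dots> = (\<Sum>c = 0..<m * ?i. (C * ctrb ?i A B) $$ (r mod p, c) * stack_past m ?i u (t + ?i) $ c)"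
    by (rule sum.mono_neutral_cong_right) (use le in auto)
  also have "\<dots> = ((C * ctrb ?i A B) *\<^sub>v stack_past m ?i u (t + ?i)) $ (r mod p)"
    using C cc p by (simp add: scalar_prod_def del: assoc_mult_mat_vec)
  also have "(C * ctrb ?i A B) *\<^sub>v stack_past m ?i u (t + ?i)
      = C *\<^sub>v (ctrb ?i A B *\<^sub>v stack_past m ?i u (t + ?i))"
    using C cc by (intro assoc_mult_mat_vec) auto
  finally show ?thesis .
qed

lemma trajectory_output:
  assumes tr: "trajectory A B C u x y"
    and A: "A \<in> carrier_mat n n" and B: "B \<in> carrier_mat n m" and C: "C \<in> carrier_mat p n"
  shows "stack_past p N y (t + N)
    = obsv N A C *\<^sub>v x t + toep N A B C *\<^sub>v stack_past m N u (t + N)"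
proof (rule eq_vecI)
  note oc = obsv_carrier[OF A C, of N] and tc = toep_carrier[OF B C, of N A]
  show "dim_vec (stack_past p N y (t + N))
    = dim_vec (obsv N A C *\<^sub>v x t + toep N A B C *\<^sub>v stack_past m N u (t + N))"
    using tc by simp
  fix r assume "r < dim_vec (obsv N A C *\<^sub>v x t + toep N A B C *\<^sub>v stack_past m N u (t + N))"
  hence r: "r < p * N" using tc by simp
  hence p: "0 < p" by (cases p) auto
  let ?i = "r div p"
  have xt: "x t \<in> carrier_vec n" using trajectoryD[OF tr A B] by auto
  note cc = ctrb_carrier[OF A B, of ?i]
  have "stack_past p N y (t + N) $ r = (C *\<^sub>v x (t + ?i)) $ (r mod p)"
    using r trajectoryD(4)[OF tr A B] by (simp add: stack_past_def)
  also have "C *\<^sub>v x (t + ?i) = C *\<^sub>v (A ^\<^sub>m ?i *\<^sub>v x t)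
      + C *\<^sub>v (ctrb ?i A B *\<^sub>v stack_past m ?i u (t + ?i))"
    unfolding trajectory_state[OF tr A B]
    by (rule mult_add_distrib_mat_vec[OF C])
       (use A xt cc in \<open>auto intro: mult_mat_vec_in_carrier pow_carrier_mat\<close>)
  also have "\<dots> $ (r mod p) = (obsv N A C *\<^sub>v x t + toep N A B C *\<^sub>v stack_past m N u (t + N)) $ r"
    using C p r tc obsv_mult_vec_index[OF A C xt r] toep_mult_stack_past_index[OF A B C r, of u t]
    by simp
  finally show "stack_past p N y (t + N) $ r
    = (obsv N A C *\<^sub>v x t + toep N A B C *\<^sub>v stack_past m N u (t + N)) $ r" .
qed

section \<open>Pseudo-inverse\<close>

text \<open>\<open>pinv\<close> is a definite description, so uniqueness is what makes it usable.
  Transposing \<open>A * X = (A * Y) * (A * X)\<close> with both factors symmetric gives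
  \<open>A * X = A * Y\<close>; the mirrored argument gives \<open>X * A = Y * A\<close>, and then
  \<open>X = Y * A * X = Y * A * Y = Y\<close>.\<close>

lemma penrose_unique:
  assumes X: "penrose A X" and Y: "penrose A Y"
  shows "X = Y"
proof -
  define r c where "r = dim_row A" and "c = dim_col A"
  have A: "A \<in> carrier_mat r c" by (simp add: r_def c_def)
  have Xc: "X \<in> carrier_mat c r" and Yc: "Y \<in> carrier_mat c r"
    using X Y by (simp_all add: penrose_def r_def c_def)
  note eqs = X[unfolded penrose_def] Y[unfolded penrose_def]
  have "A * X = A * Y * (A * X)"
    using eqs A Xc Yc assoc_mult_mat[of "A * Y" r r A c X r] by auto
  hence "transpose_mat (A * X) = transpose_mat (A * X) * transpose_mat (A * Y)"
    using transpose_mult[of "A * Y" r r "A * X" r] A Xc Yc by (metis mult_carrier_mat)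
  hence "A * X = A * X * (A * Y)" using eqs by simp
  also have "\<dots> = A * Y"
    using eqs A Xc Yc assoc_mult_mat[of "A * X" r r A c Y r] by auto
  finally have AX: "A * X = A * Y" .
  have "X * A = X * A * (Y * A)"
    using eqs A Xc Yc assoc_mult_mat[of X c r "A * Y" r A c] assoc_mult_mat[of X c r A c "Y * A" c]
      assoc_mult_mat[of A r c Y r A c] by auto
  hence "transpose_mat (X * A) = transpose_mat (Y * A) * transpose_mat (X * A)"
    using transpose_mult[of "X * A" c c "Y * A" c] A Xc Yc by (metis mult_carrier_mat)
  hence "X * A = Y * A * (X * A)" using eqs by simp
  also have "\<dots> = Y * (A * X * A)"
    using A Xc Yc assoc_mult_mat[of Y c r A c "X * A" c] assoc_mult_mat[of A r c X r A c] by auto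
  finally have XA: "X * A = Y * A" using eqs by simp
  have "X = Y * A * X" using eqs XA by metis
  also have "\<dots> = Y * (A * Y)" using AX A Xc Yc by auto
  also have "\<dots> = Y" using eqs A Yc assoc_mult_mat[of Y c r A c Y r] by auto
  finally show ?thesis .
qed

lemma scalar_prod_self_eq_0:
  fixes v :: "real vec"
  assumes "v \<bullet> v = 0" "v \<in> carrier_vec k"
  shows "v = 0\<^sub>v k"
proof (rule eq_vecI)
  fix i assume "i < dim_vec (0\<^sub>v k :: real vec)"
  hence i: "i < k" by simp
  have "(\<Sum>j = 0..<k. v $ j * v $ j) = 0" using assms by (simp add: scalar_prod_def)
  hence "v $ i * v $ i = 0" using i by (subst (asm) sum_nonneg_eq_0_iff) auto
  thus "v $ i = 0\<^sub>v k $ i" using i by simp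
qed (use assms in auto)

text \<open>With full column rank the Gram matrix of \<open>A\<close> is invertible, since a kernel
  vector \<open>v\<close> makes the squared norm of \<open>A v\<close> vanish. The inverse Gram
  matrix times the transpose of \<open>A\<close> satisfies the Penrose equations.\<close>

lemma pinv_left_inverse:
  assumes A: "A \<in> carrier_mat r c" and rk: "mat_rank A = c"
  shows "pinv A \<in> carrier_mat c r" "pinv A * A = 1\<^sub>m c"
proof -
  let ?T = "transpose_mat A"
  have T: "?T \<in> carrier_mat c r" using A by simp
  define G where "G = ?T * A"
  have G: "G \<in> carrier_mat c c" using A by (simp add: G_def)
  have Gsym: "transpose_mat G = G" using transpose_mult[OF T A] by (simp add: G_def)
  have "v = 0\<^sub>v c" if v: "v \<in> carrier_vec c" and Gv: "G *\<^sub>v v = 0\<^sub>v c" for v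
  proof -
    have Av: "A *\<^sub>v v \<in> carrier_vec r" using A v by simp
    have "(A *\<^sub>v v) \<bullet> (A *\<^sub>v v) = v \<bullet> (?T *\<^sub>v (A *\<^sub>v v))"
      using transpose_vec_mult_scalar[OF T Av v] A by (simp add: comm_scalar_prod[of _ c] Av v)
    also have "\<dots> = v \<bullet> (G *\<^sub>v v)" using A v by (simp add: G_def)
    also have "\<dots> = 0" using Gv v by simp
    finally have "A *\<^sub>v v = 0\<^sub>v r" using scalar_prod_self_eq_0 Av by blast
    thus ?thesis using mat_rank_eq_dim_col_iff[OF A] rk v by blast
  qed
  hence "det G \<noteq> 0" using det_0_iff_vec_prod_zero_field[OF G] by blast
  from det_non_zero_imp_unit[OF G this, of "()"]
  obtain H where H: "H \<in> carrier_mat c c" "H * G = 1\<^sub>m c" "G * H = 1\<^sub>m c"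
    by (auto simp: Units_def ring_mat_simps)
  \<comment> \<open>As \<open>G\<close> is symmetric, transposing \<open>G * H\<close> yields
    another left inverse, which must equal \<open>H\<close>; the symmetry of \<open>A * X\<close>
    rests on this.\<close>
  have "transpose_mat H * G = 1\<^sub>m c" using transpose_mult[OF G H(1)] H(3) Gsym by simp
  hence Hsym: "transpose_mat H = H"
    using assoc_mult_mat[of "transpose_mat H" c c G c H c] H G by simp
  define X where "X = H * ?T"
  have X: "X \<in> carrier_mat c r" using H T by (simp add: X_def)
  have XA: "X * A = 1\<^sub>m c" using H T A by (simp add: X_def G_def)
  have AX: "A * X = A * H * ?T" using H T A by (simp add: X_def)
  have "transpose_mat (A * X) = A * (transpose_mat H * ?T)"
    unfolding AX using transpose_mult[of "A * H" r c ?T r] transpose_mult[of A r c H c] A H T by simp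
  hence "transpose_mat (A * X) = A * X" using Hsym by (simp add: X_def)
  hence "penrose A X" using X XA A assoc_mult_mat[of A r c X r A c] by (auto simp: penrose_def)
  hence "pinv A = X" unfolding pinv_def using penrose_unique by blast
  thus "pinv A \<in> carrier_mat c r" "pinv A * A = 1\<^sub>m c" using X XA by auto
qed

section \<open>Shift and injection matrices\<close>

text \<open>Row \<open>i\<close> is a row of a matrix with an identity block placed at row offset
  \<open>a\<close>; \<open>Gamma_mat\<close> and \<open>Bm_mat\<close> are the two
  instances.\<close>

lemma selector_mult_vec_index:
  fixes G :: "real mat"
  assumes "G \<in> carrier_mat r k" "z \<in> carrier_vec k" "i < r"
    and "\<And>j. j < k \<Longrightarrow> G $$ (i, j) = (if i = a + j then 1 else 0)"
  shows "(G *\<^sub>v z) $ i = (if a \<le> i \<and> i < a + k then z $ (i - a) else 0)"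
proof -
  have "(G *\<^sub>v z) $ i = (\<Sum>j = 0..<k. G $$ (i, j) * z $ j)"
    using assms by (simp add: scalar_prod_def)
  also have "\<dots> = (\<Sum>j = 0..<k. if j = i - a \<and> a \<le> i then z $ j else 0)"
    using assms(4) by (intro sum.cong) auto
  also have "\<dots> = (if a \<le> i \<and> i < a + k then z $ (i - a) else 0)"
    by (cases "a \<le> i") (auto simp: less_diff_conv2)
  finally show ?thesis .
qed

lemma Gamma_mat_carrier:
  assumes "0 < N" shows "Gamma_mat m p N \<in> carrier_mat (m * N + p * N) p"
proof -
  have "m * N + p * (N - 1) + p = m * N + p * N" using assms by (cases N) auto
  thus ?thesis unfolding Gamma_mat_def append_cols_def by auto
qed

lemma Bm_mat_carrier:
  assumes "0 < N" shows "Bm_mat m p N \<in> carrier_mat (m * N + p * N) m"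
proof -
  have "m * (N - 1) + (m + p * N) = m * N + p * N" using assms by (cases N) auto
  thus ?thesis unfolding Bm_mat_def append_cols_def by auto
qed

lemma block_shift_carrier:
  assumes "0 < N" shows "block_shift k N \<in> carrier_mat (k * N) (k * N)"
proof -
  have "k * (N - 1) + k = k * N" "k + k * (N - 1) = k * N" using assms by (cases N; auto)+
  thus ?thesis unfolding block_shift_def by auto
qed

lemma Gamma_mat_mult_vec_index:
  assumes N: "0 < N" and z: "z \<in> carrier_vec p" and i: "i < m * N + p * N"
  shows "(Gamma_mat m p N *\<^sub>v z) $ i
    = (if m * N + p * (N - 1) \<le> i then z $ (i - (m * N + p * (N - 1))) else 0)"
proof -
  have eq: "m * N + p * (N - 1) + p = m * N + p * N" using N by (cases N) auto
  have "(Gamma_mat m p N *\<^sub>v z) $ i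
    = (if m * N + p * (N - 1) \<le> i \<and> i < m * N + p * (N - 1) + p
       then z $ (i - (m * N + p * (N - 1))) else 0)"
    by (rule selector_mult_vec_index[OF Gamma_mat_carrier[OF N] z i])
       (use i eq in \<open>auto simp: Gamma_mat_def append_cols_def\<close>)
  thus ?thesis using i eq by auto
qed

lemma Bm_mat_mult_vec_index:
  assumes N: "0 < N" and z: "z \<in> carrier_vec m" and i: "i < m * N + p * N"
  shows "(Bm_mat m p N *\<^sub>v z) $ i
    = (if m * (N - 1) \<le> i \<and> i < m * N then z $ (i - m * (N - 1)) else 0)"
proof -
  have eq: "m * (N - 1) + m = m * N" using N by (cases N) auto
  have "(Bm_mat m p N *\<^sub>v z) $ i
    = (if m * (N - 1) \<le> i \<and> i < m * (N - 1) + m then z $ (i - m * (N - 1)) else 0)"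
    by (rule selector_mult_vec_index[OF Bm_mat_carrier[OF N] z i])
       (use i eq in \<open>auto simp: Bm_mat_def append_cols_def\<close>)
  thus ?thesis using eq by simp
qed

lemma block_shift_mult_vec_index:
  assumes N: "0 < N" and z: "z \<in> carrier_vec (k * N)" and i: "i < k * N"
  shows "(block_shift k N *\<^sub>v z) $ i = (if i < k * (N - 1) then z $ (i + k) else 0)"
proof -
  have eq: "k * (N - 1) + k = k * N" using N by (cases N) auto
  have "(block_shift k N *\<^sub>v z) $ i = (\<Sum>j = 0..<k * N. block_shift k N $$ (i, j) * z $ j)"
    using block_shift_carrier[OF N, of k] z i by (simp add: scalar_prod_def)
  also have "\<dots> = (\<Sum>j = 0..<k * N. if j = i + k then if i < k * (N - 1) then z $ j else 0 else 0)"
    using i eq by (intro sum.cong) (auto simp: block_shift_def)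
  also have "\<dots> = (if i < k * (N - 1) then z $ (i + k) else 0)"
    using eq by auto
  finally show ?thesis .
qed

lemma Omega_mat_eq:
  "Omega_mat m p N = four_block_mat (block_shift m N) (0\<^sub>m (dim_row (block_shift m N)) (dim_col (block_shift p N)))
     (0\<^sub>m (dim_row (block_shift p N)) (dim_col (block_shift m N))) (block_shift p N)"
  unfolding Omega_mat_def diag_block_mat.simps(2)[of _ "[block_shift p N]"] diag_block_mat_singleton Let_def ..

lemma Omega_mat_carrier:
  assumes "0 < N" shows "Omega_mat m p N \<in> carrier_mat (m * N + p * N) (m * N + p * N)"
  unfolding Omega_mat_eq using block_shift_carrier[OF assms] by (intro four_block_carrier_mat) auto

lemma Omega_mat_mult_vec:
  assumes "0 < N" "a \<in> carrier_vec (m * N)" "b \<in> carrier_vec (p * N)"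
  shows "Omega_mat m p N *\<^sub>v (a @\<^sub>v b) = (block_shift m N *\<^sub>v a) @\<^sub>v (block_shift p N *\<^sub>v b)"
  using mult_mat_vec_split[of "block_shift m N" "m * N" "block_shift p N" "p * N" a b]
    block_shift_carrier[OF assms(1), of m] block_shift_carrier[OF assms(1), of p] assms
  unfolding Omega_mat_eq by simp

text \<open>Sliding the window by one step drops the oldest block and appends \<open>w t\<close>.
  The assumption \<open>N \<le> t\<close> ensures that the start of the window really moves by
  one.\<close>

lemma stack_past_shift:
  assumes "0 < N" "N \<le> t" "i < k * N"
  shows "stack_past k N w (Suc t) $ i
    = (if i < k * (N - 1) then stack_past k N w t $ (i + k) else w t $ (i - k * (N - 1)))"
proof -
  obtain N' where N': "N = Suc N'" using assms by (cases N) auto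
  have k: "0 < k" using assms by (cases k) auto
  show ?thesis
  proof (cases "i < k * N'")
    case True
    have "t - N' + i div k = t - N + (i + k) div k" using assms N' k by simp
    then show ?thesis using True assms N' by (simp add: stack_past_def)
  next
    case False
    then obtain j where j: "i = k * N' + j" "j < k"
      using assms(3) N' by (metis add.commute add_less_cancel_left le_add_diff_inverse mult_Suc_right not_less)
    then show ?thesis using False assms N' k by (simp add: stack_past_def)
  qed
qed

lemma xi_carrier [simp]: "xi m p N u y t \<in> carrier_vec (m * N + p * N)"
  by (simp add: xi_def)

text \<open>\<open>Omega_mat\<close> shifts both halves and leaves the last block of each empty;
  \<open>Bm_mat\<close> fills the first gap with \<open>u t\<close> and \<open>Gamma_mat\<close> the
  second with \<open>C K\<close> applied to the window. Only the prediction of the current output is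
  asked of \<open>K\<close>.\<close>

lemma lifted_step:
  assumes N: "0 < N" "N \<le> t" and u: "u t \<in> carrier_vec m"
    and C: "C \<in> carrier_mat p n" and K: "K \<in> carrier_mat n (m * N + p * N)"
    and y: "y t = C *\<^sub>v (K *\<^sub>v xi m p N u y t)"
  shows "(Omega_mat m p N + Gamma_mat m p N * C * K) *\<^sub>v xi m p N u y t + Bm_mat m p N *\<^sub>v u t
    = xi m p N u y (Suc t)"
proof -
  let ?d = "m * N + p * N" and ?z = "xi m p N u y t"
  note carr = Omega_mat_carrier[OF N(1), of m p] Gamma_mat_carrier[OF N(1), of m p]
    Bm_mat_carrier[OF N(1), of m p]
  have yt: "y t \<in> carrier_vec p" using y C by (auto intro: mult_mat_vec_in_carrier)
  have Kz: "K *\<^sub>v ?z \<in> carrier_vec n" using K by (auto intro: mult_mat_vec_in_carrier)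
  have "(Omega_mat m p N + Gamma_mat m p N * C * K) *\<^sub>v ?z
      = Omega_mat m p N *\<^sub>v ?z + (Gamma_mat m p N * C * K) *\<^sub>v ?z"
    by (rule add_mult_distrib_mat_vec[of _ ?d ?d]) (use carr C K in auto)
  also have "(Gamma_mat m p N * C * K) *\<^sub>v ?z = Gamma_mat m p N *\<^sub>v y t"
    using assoc_mult_mat_vec[of "Gamma_mat m p N * C" ?d n K ?d ?z] C K carr(2)
      assoc_mult_mat_vec[of "Gamma_mat m p N" ?d p C n "K *\<^sub>v ?z"] Kz y by simp
  also have "Omega_mat m p N *\<^sub>v ?z
      = (block_shift m N *\<^sub>v stack_past m N u t) @\<^sub>v (block_shift p N *\<^sub>v stack_past p N y t)"
    unfolding xi_def by (rule Omega_mat_mult_vec) (use N in auto)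
  finally have lhs: "(Omega_mat m p N + Gamma_mat m p N * C * K) *\<^sub>v ?z = \<dots> + Gamma_mat m p N *\<^sub>v y t" .
  have bs: "block_shift k N \<in> carrier_mat (k * N) (k * N)" for k by (rule block_shift_carrier[OF N(1)])
  show ?thesis unfolding lhs
  proof (rule eq_vecI)
    show "dim_vec (((block_shift m N *\<^sub>v stack_past m N u t) @\<^sub>v (block_shift p N *\<^sub>v stack_past p N y t))
        + Gamma_mat m p N *\<^sub>v y t + Bm_mat m p N *\<^sub>v u t) = dim_vec (xi m p N u y (Suc t))"
      using carr by (simp add: xi_def)
    fix i assume "i < dim_vec (xi m p N u y (Suc t))"
    hence i: "i < ?d" by (simp add: xi_def)
    show "(((block_shift m N *\<^sub>v stack_past m N u t) @\<^sub>v (block_shift p N *\<^sub>v stack_past p N y t))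
        + Gamma_mat m p N *\<^sub>v y t + Bm_mat m p N *\<^sub>v u t) $ i = xi m p N u y (Suc t) $ i"
    proof (cases "i < m * N")
      case True
      then show ?thesis using carr bs[of m] bs[of p] i N
        by (simp add: xi_def Gamma_mat_mult_vec_index[OF N(1) yt i] Bm_mat_mult_vec_index[OF N(1) u i]
            block_shift_mult_vec_index[OF N(1)] stack_past_shift del: index_mult_mat_vec)
    next
      case False
      have jlt: "i - m * N < p * N" using i False by simp
      have "m * (N - 1) \<le> m * N" by simp
      hence "\<not> i < m * (N - 1)" using False by linarith
      moreover have "i - m * N < p * (N - 1) \<longleftrightarrow> \<not> m * N + p * (N - 1) \<le> i" using False by linarith
      moreover have "i - m * N - p * (N - 1) = i - (m * N + p * (N - 1))" by simp
      ultimately show ?thesis using carr bs[of m] bs[of p] i N jlt False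
        by (simp add: xi_def Gamma_mat_mult_vec_index[OF N(1) yt i] Bm_mat_mult_vec_index[OF N(1) u i]
            block_shift_mult_vec_index[OF N(1)] stack_past_shift del: index_mult_mat_vec)
    qed
  qed
qed

section \<open>The lifted system\<close>

lemma trajectory_exists:
  assumes A: "A \<in> carrier_mat d d" and B: "B \<in> carrier_mat d m"
    and x0: "x0 \<in> carrier_vec d" and u: "\<And>t. u t \<in> carrier_vec m"
  obtains x y where "trajectory A B C u x y" "x 0 = x0"
proof -
  define x where "x = rec_nat x0 (\<lambda>t z. A *\<^sub>v z + B *\<^sub>v u t)"
  have "x t \<in> carrier_vec d" for t
    by (induction t) (use A B x0 u in \<open>auto simp: x_def intro!: add_carrier_vec mult_mat_vec_in_carrier\<close>)
  hence "trajectory A B C u x (\<lambda>t. C *\<^sub>v x t)"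
    unfolding trajectory_def using A B u by (auto simp: x_def)
  thus thesis using that by (auto simp: x_def)
qed

lemma trajectory_rest:
  assumes tr: "trajectory A B C u x y" and A: "A \<in> carrier_mat d d" and B: "B \<in> carrier_mat d m"
    and x0: "x 0 = 0\<^sub>v d" and u: "\<And>t. t < k \<Longrightarrow> u t = 0\<^sub>v m" and "t \<le> k"
  shows "x t = 0\<^sub>v d"
  using \<open>t \<le> k\<close>
proof (induction t)
  case (Suc t)
  then show ?case using trajectoryD(3)[OF tr A B, of t] u[of t] mult_mat_vec_zero[OF A] mult_mat_vec_zero[OF B] by simp
qed (simp add: x0)

lemma xi_zero:
  assumes "\<And>i. i < N \<Longrightarrow> u (t - N + i) = 0\<^sub>v m" "\<And>i. i < N \<Longrightarrow> y (t - N + i) = 0\<^sub>v p"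
  shows "xi m p N u y t = 0\<^sub>v (m * N + p * N)"
proof -
  have zero: "stack_past k N w t = 0\<^sub>v (k * N)" if "\<And>i. i < N \<Longrightarrow> w (t - N + i) = 0\<^sub>v k"
    for k and w :: "nat \<Rightarrow> real vec"
  proof (rule eq_vecI)
    fix i assume "i < dim_vec (0\<^sub>v (k * N) :: real vec)"
    hence i: "i < k * N" by simp
    hence "i div k < N" "i mod k < k" by (cases "k = 0"; simp add: less_mult_imp_div_less mult.commute)+
    thus "stack_past k N w t $ i = 0\<^sub>v (k * N) $ i" using i that by (simp add: stack_past_def)
  qed simp
  have "stack_past m N u t = 0\<^sub>v (m * N)" "stack_past p N y t = 0\<^sub>v (p * N)"
    using assms by (auto intro!: zero)
  thus ?thesis unfolding xi_def by (intro eq_vecI) auto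
qed

text \<open>Observability enters as full column rank at the window length itself. \<open>M0\<close>
  is left out, so that results about \<open>M\<close> are available for verifying the kernel
  condition on a concrete \<open>M0\<close>.\<close>

locale io_system =
  fixes n m p N :: nat and A B C :: "real mat"
  assumes n_pos: "0 < n" and m_pos: "0 < m" and N_pos: "0 < N"
    and A: "A \<in> carrier_mat n n" and B: "B \<in> carrier_mat n m" and C: "C \<in> carrier_mat p n"
    and ctrl: "controllable A B" and obs: "mat_rank (obsv N A C) = n"
begin

abbreviation d :: nat where "d \<equiv> m * N + p * N"

text \<open>Here \<open>x\<close> is the state at the start of the window, not the current
  one.\<close>

definition io_windows :: "real vec set" where
  "io_windows = {U @\<^sub>v (obsv N A C *\<^sub>v x + toep N A B C *\<^sub>v U) | U x.
     U \<in> carrier_vec (m * N) \<and> x \<in> carrier_vec n}"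

text \<open>The common property of \<open>M\<close> and \<open>M + M0\<close> on which all results
  about the lifted system rest.\<close>

definition reads_state :: "real mat \<Rightarrow> bool" where
  "reads_state K \<longleftrightarrow> K \<in> carrier_mat n d \<and>
     (\<forall>u x y. trajectory A B C u x y \<longrightarrow> (\<forall>t\<ge>N. K *\<^sub>v xi m p N u y t = x t))"

lemmas oc = obsv_carrier[OF A C, of N]
lemmas tc = toep_carrier[OF B C, of N A]

lemma n_le_outputs: "n \<le> p * N"
  using mat_rank_le_dim_row[of "obsv N A C"] obs oc by simp

lemma obsv_inj: "v \<in> carrier_vec n \<Longrightarrow> obsv N A C *\<^sub>v v = 0\<^sub>v (p * N) \<Longrightarrow> v = 0\<^sub>v n"
  using mat_rank_eq_dim_col_iff[OF oc] obs by blast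

text \<open>The factor is the block matrix with rows \<open>[1, 0]\<close> and
  \<open>[toep, obsv]\<close>. It is injective: the upper rows return \<open>U\<close>, and what
  remains of the lower ones is the injective \<open>obsv N A C\<close>.\<close>

lemma io_windows_eq_image:
  "\<exists>F \<in> carrier_mat d (m * N + n). mat_image F = io_windows \<and> mat_rank F = m * N + n"
proof
  let ?F = "four_block_mat (1\<^sub>m (m * N)) (0\<^sub>m (m * N) n) (toep N A B C) (obsv N A C)"
  show F: "?F \<in> carrier_mat d (m * N + n)" using oc by (intro four_block_carrier_mat) auto
  have app: "?F *\<^sub>v (U @\<^sub>v x) = U @\<^sub>v (obsv N A C *\<^sub>v x + toep N A B C *\<^sub>v U)"
    if U: "U \<in> carrier_vec (m * N)" and x: "x \<in> carrier_vec n" for U x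
  proof -
    have "toep N A B C *\<^sub>v U + obsv N A C *\<^sub>v x = obsv N A C *\<^sub>v x + toep N A B C *\<^sub>v U"
      by (rule comm_add_vec[of _ "p * N"]) (use tc oc in \<open>auto intro: mult_mat_vec_in_carrier\<close>)
    moreover have "0\<^sub>m (m * N) n *\<^sub>v x = 0\<^sub>v (m * N)" using x by (intro eq_vecI) auto
    ultimately show ?thesis
      using four_block_mat_mult_vec[of "1\<^sub>m (m * N)" "m * N" "m * N" "0\<^sub>m (m * N) n" n
        "toep N A B C" "p * N" "obsv N A C" U x] U x oc tc by simp
  qed
  have split: "\<exists>U x. U \<in> carrier_vec (m * N) \<and> x \<in> carrier_vec n \<and> v = U @\<^sub>v x"
    if "v \<in> carrier_vec (m * N + n)" for v :: "real vec"
    using vec_first_last_append[OF that] vec_first_carrier vec_last_carrier by metis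
  have "mat_image ?F = io_windows"
    unfolding mat_image_eq[OF F] io_windows_def
  proof (intro equalityI subsetI)
    fix v assume "v \<in> (\<lambda>v. ?F *\<^sub>v v) ` carrier_vec (m * N + n)"
    then obtain w where w: "w \<in> carrier_vec (m * N + n)" "v = ?F *\<^sub>v w" by blast
    from split[OF w(1)] obtain U x where "U \<in> carrier_vec (m * N)" "x \<in> carrier_vec n" "w = U @\<^sub>v x"
      by blast
    with w app show "v \<in> {U @\<^sub>v (obsv N A C *\<^sub>v x + toep N A B C *\<^sub>v U) | U x.
        U \<in> carrier_vec (m * N) \<and> x \<in> carrier_vec n}" by blast
  next
    fix v assume "v \<in> {U @\<^sub>v (obsv N A C *\<^sub>v x + toep N A B C *\<^sub>v U) | U x.
        U \<in> carrier_vec (m * N) \<and> x \<in> carrier_vec n}"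
    then obtain U x where Ux: "U \<in> carrier_vec (m * N)" "x \<in> carrier_vec n"
      "v = U @\<^sub>v (obsv N A C *\<^sub>v x + toep N A B C *\<^sub>v U)" by blast
    hence "v = ?F *\<^sub>v (U @\<^sub>v x)" using app by simp
    thus "v \<in> (\<lambda>v. ?F *\<^sub>v v) ` carrier_vec (m * N + n)" using Ux by blast
  qed
  moreover have "mat_rank ?F = m * N + n"
    unfolding mat_rank_eq_dim_col_iff[OF F]
  proof (intro ballI impI)
    fix v :: "real vec" assume v: "v \<in> carrier_vec (m * N + n)" and Fv: "?F *\<^sub>v v = 0\<^sub>v d"
    from split[OF v] obtain U x where U: "U \<in> carrier_vec (m * N)" and x: "x \<in> carrier_vec n"
      and vU: "v = U @\<^sub>v x" by blast
    have z: "0\<^sub>v d = 0\<^sub>v (m * N) @\<^sub>v (0\<^sub>v (p * N) :: real vec)" by (intro eq_vecI) auto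
    have "U @\<^sub>v (obsv N A C *\<^sub>v x + toep N A B C *\<^sub>v U) = 0\<^sub>v (m * N) @\<^sub>v 0\<^sub>v (p * N)"
      using Fv app[OF U x] vU z by simp
    hence U0: "U = 0\<^sub>v (m * N)" and O0: "obsv N A C *\<^sub>v x + toep N A B C *\<^sub>v U = 0\<^sub>v (p * N)"
      using append_vec_eq[OF U, of "0\<^sub>v (m * N)"] by auto
    have "obsv N A C *\<^sub>v x = 0\<^sub>v (p * N)"
      using O0 mult_mat_vec_in_carrier[OF oc, of x] unfolding U0 mult_mat_vec_zero[OF tc] by simp
    hence "x = 0\<^sub>v n" using obsv_inj x by blast
    thus "v = 0\<^sub>v (m * N + n)" unfolding vU U0 by (intro eq_vecI) auto
  qed
  ultimately show "mat_image ?F = io_windows \<and> mat_rank ?F = m * N + n" by blast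
qed

lemma xi_eq_window:
  assumes "trajectory A B C u x y"
  shows "xi m p N u y (t + N) = stack_past m N u (t + N)
    @\<^sub>v (obsv N A C *\<^sub>v x t + toep N A B C *\<^sub>v stack_past m N u (t + N))"
  unfolding xi_def trajectory_output[OF assms A B C] ..

lemma xi_in_io_windows:
  assumes "trajectory A B C u x y"
  shows "xi m p N u y (t + N) \<in> io_windows"
  unfolding xi_eq_window[OF assms] io_windows_def
  using trajectoryD(2)[OF assms A B, of t] stack_past_carrier by blast

lemma M_mat_carrier: "M_mat N A B C \<in> carrier_mat n d"
  unfolding M_mat_def
  by (intro append_cols_carrier minus_carrier_mat mult_carrier_mat[of _ n n] mult_carrier_mat[of _ n "p * N"])
     (use pinv_left_inverse(1)[OF oc obs] A tc in \<open>auto intro: mult_carrier_mat\<close>)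

text \<open>Subtracting the forced response from the output half leaves \<open>obsv N A C\<close>
  applied to the state at the start of the window. The pseudo-inverse recovers that state, and
  \<open>N\<close> steps of the dynamics carry it to time \<open>t\<close>; \<open>M\<close>
  collects the coefficients of inputs and outputs.\<close>

lemma M_mat_reads_state: "reads_state (M_mat N A B C)"
  unfolding reads_state_def
proof (intro conjI allI impI)
  show "M_mat N A B C \<in> carrier_mat n d" by (rule M_mat_carrier)
  fix u x y t assume tr: "trajectory A B C u x y" and "N \<le> t"
  then obtain s where t: "t = s + N" using le_Suc_ex by (metis add.commute)
  let ?U = "stack_past m N u t" and ?O = "obsv N A C" and ?T = "toep N A B C"
  define L where "L = A ^\<^sub>m N * pinv ?O"
  define R where "R = ctrb N A B"
  have Rc: "R \<in> carrier_mat n (m * N)" unfolding R_def by (rule ctrb_carrier[OF A B])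
  note Pc = pinv_left_inverse(1)[OF oc obs]
  have Lc: "L \<in> carrier_mat n (p * N)" using A Pc by (auto simp: L_def)
  have xs: "x s \<in> carrier_vec n" using trajectoryD[OF tr A B] by blast
  have Ox: "?O *\<^sub>v x s \<in> carrier_vec (p * N)" and TU: "?T *\<^sub>v ?U \<in> carrier_vec (p * N)"
    using oc tc by (auto intro: mult_mat_vec_in_carrier)
  have LO: "L *\<^sub>v (?O *\<^sub>v x s) = A ^\<^sub>m N *\<^sub>v x s"
  proof -
    have "L * ?O = A ^\<^sub>m N * (pinv ?O * ?O)"
      unfolding L_def by (rule assoc_mult_mat) (use A Pc oc in auto)
    also have "\<dots> = A ^\<^sub>m N" using pinv_left_inverse(2)[OF oc obs] A by simp
    finally show ?thesis using assoc_mult_mat_vec[OF Lc oc xs] by simp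
  qed
  have "M_mat N A B C *\<^sub>v xi m p N u y t = (R - L * ?T) *\<^sub>v ?U + L *\<^sub>v (?O *\<^sub>v x s + ?T *\<^sub>v ?U)"
    unfolding t xi_eq_window[OF tr] M_mat_def L_def[symmetric] R_def[symmetric]
    by (rule append_cols_mult_vec) (use Rc Lc tc Ox TU t in auto)
  also have "(R - L * ?T) *\<^sub>v ?U = R *\<^sub>v ?U - L *\<^sub>v (?T *\<^sub>v ?U)"
    using minus_mult_distrib_mat_vec[of R n "m * N" "L * ?T" ?U] Rc Lc tc
      assoc_mult_mat_vec[OF Lc tc, of ?U] by simp
  also have "L *\<^sub>v (?O *\<^sub>v x s + ?T *\<^sub>v ?U) = A ^\<^sub>m N *\<^sub>v x s + L *\<^sub>v (?T *\<^sub>v ?U)"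
    using mult_add_distrib_mat_vec[OF Lc Ox TU] LO by simp
  also have "R *\<^sub>v ?U - L *\<^sub>v (?T *\<^sub>v ?U) + (A ^\<^sub>m N *\<^sub>v x s + L *\<^sub>v (?T *\<^sub>v ?U))
      = A ^\<^sub>m N *\<^sub>v x s + R *\<^sub>v ?U"
    using Rc Lc A by (intro eq_vecI) (auto simp del: index_mult_mat_vec)
  also have "\<dots> = x t" unfolding t R_def trajectory_state[OF tr A B] ..
  finally show "M_mat N A B C *\<^sub>v xi m p N u y t = x t" .
qed

lemma lifted_carrier:
  assumes "K \<in> carrier_mat n d"
  shows "Omega_mat m p N + Gamma_mat m p N * C * K \<in> carrier_mat d d" "Bm_mat m p N \<in> carrier_mat d m"
  using Omega_mat_carrier[OF N_pos] Gamma_mat_carrier[OF N_pos] Bm_mat_carrier[OF N_pos] C assms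
  by (auto intro!: add_carrier_mat mult_carrier_mat)

text \<open>Everything is delayed by \<open>N\<close>, because only from time \<open>N\<close> on is
  the whole window part of the trajectory.\<close>

lemma lifted_trajectory:
  assumes K: "reads_state K" and tr: "trajectory A B C u x y"
  shows "trajectory (Omega_mat m p N + Gamma_mat m p N * C * K) (Bm_mat m p N) (C * K)
    (\<lambda>t. u (t + N)) (\<lambda>t. xi m p N u y (t + N)) (\<lambda>t. y (t + N))"
proof -
  have Kc: "K \<in> carrier_mat n d" using K by (simp add: reads_state_def)
  note lc = lifted_carrier[OF Kc]
  have Kx: "K *\<^sub>v xi m p N u y (t + N) = x (t + N)" for t
    using K tr by (simp add: reads_state_def)
  have y: "y (t + N) = C *\<^sub>v (K *\<^sub>v xi m p N u y (t + N))" for t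
    using Kx trajectoryD(4)[OF tr A B] by simp
  have "(C * K) *\<^sub>v xi m p N u y (t + N) = C *\<^sub>v (K *\<^sub>v xi m p N u y (t + N))" for t
    by (rule assoc_mult_mat_vec[OF C Kc]) simp
  moreover have "xi m p N u y (Suc (t + N)) = (Omega_mat m p N + Gamma_mat m p N * C * K)
      *\<^sub>v xi m p N u y (t + N) + Bm_mat m p N *\<^sub>v u (t + N)" for t
    by (rule lifted_step[symmetric, OF N_pos _ _ C Kc y]) (use trajectoryD(1)[OF tr A B] in auto)
  ultimately show ?thesis
    unfolding trajectory_def using lc trajectoryD(1)[OF tr A B] y by auto
qed

text \<open>Rest during the first \<open>N\<close> steps makes inputs and outputs vanish, so the
  lifted state at time \<open>N\<close> is zero and only the forced response survives.\<close>

lemma lifted_reach: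
  assumes K: "reads_state K" and tr: "trajectory A B C u x y"
    and x0: "x 0 = 0\<^sub>v n" and u0: "\<And>t. t < N \<Longrightarrow> u t = 0\<^sub>v m"
  shows "xi m p N u y (k + N) = ctrb k (Omega_mat m p N + Gamma_mat m p N * C * K) (Bm_mat m p N)
    *\<^sub>v stack_past m k (\<lambda>t. u (t + N)) k"
proof -
  let ?A = "Omega_mat m p N + Gamma_mat m p N * C * K" and ?B = "Bm_mat m p N"
  have Kc: "K \<in> carrier_mat n d" using K by (simp add: reads_state_def)
  note lc = lifted_carrier[OF Kc]
  have "y i = 0\<^sub>v p" if "i < N" for i
    using trajectory_rest[OF tr A B x0 u0, of N i] trajectoryD(4)[OF tr A B, of i]
      mult_mat_vec_zero[OF C] that by simp
  hence z: "xi m p N u y N = 0\<^sub>v d" using u0 by (intro xi_zero) auto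
  have "xi m p N u y (k + N) = ?A ^\<^sub>m k *\<^sub>v xi m p N u y N + ctrb k ?A ?B *\<^sub>v stack_past m k (\<lambda>t. u (t + N)) k"
    using trajectory_state[OF lifted_trajectory[OF K tr] lc, of 0 k] by simp
  also have "?A ^\<^sub>m k *\<^sub>v xi m p N u y N = 0\<^sub>v d" unfolding z
    by (rule mult_mat_vec_zero[OF pow_carrier_mat[OF lc(1)]])
  finally show ?thesis
    using mult_mat_vec_in_carrier[OF ctrb_carrier[OF lc, of k]] by simp
qed

lemma controllable_state:
  assumes "z \<in> carrier_vec n"
  obtains w where "\<And>i. w i \<in> carrier_vec m" "z = ctrb n A B *\<^sub>v stack_past m n w n"
proof -
  note cc = ctrb_carrier[OF A B, of n]
  have "mat_rank (ctrb n A B) = n" using ctrl A by (simp add: controllable_def ctrb_mat_def)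
  hence "z \<in> mat_image (ctrb n A B)" using full_row_rank_image[OF cc] assms by simp
  then obtain v where "v \<in> carrier_vec (m * n)" "z = ctrb n A B *\<^sub>v v"
    unfolding mat_image_eq[OF cc] by blast
  thus thesis using stack_past_surj[of v m n n] that by blast
qed

text \<open>A window reached by the lifted system is the window of a trajectory that has been at rest for
  \<open>N\<close> steps; steering from rest to an arbitrary state takes \<open>n\<close> steps and filling the window another
  \<open>N\<close>, and \<open>n + N\<close> does not exceed the dimension of the lifted system.\<close>

lemma image_ctrb_lifted:
  assumes K: "reads_state K"
  shows "mat_image (ctrb_mat (Omega_mat m p N + Gamma_mat m p N * C * K) (Bm_mat m p N)) = io_windows"
proof -
  let ?A = "Omega_mat m p N + Gamma_mat m p N * C * K" and ?B = "Bm_mat m p N"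
  have Kc: "K \<in> carrier_mat n d" using K by (simp add: reads_state_def)
  note lc = lifted_carrier[OF Kc]
  have ctrb_eq: "ctrb_mat ?A ?B = ctrb d ?A ?B" 
    unfolding ctrb_mat_def carrier_matD(1)[OF lc(1)] ..
  note cc = ctrb_carrier[OF lc, of d]
  \<comment> \<open>The rank of \<open>obsv N A C\<close> gives \<open>n \<le> p * N\<close>, and
    \<open>m\<close> positive gives \<open>N \<le> m * N\<close>.\<close>
  have dge: "n + N \<le> d"
    using n_le_outputs m_pos by (metis add.commute add_mono mult_le_mono1 mult_1 Suc_leI One_nat_def)
  show ?thesis unfolding ctrb_eq mat_image_eq[OF cc]
  proof (intro equalityI subsetI)
    fix v assume "v \<in> (\<lambda>v. ctrb d ?A ?B *\<^sub>v v) ` carrier_vec (m * d)"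
    then obtain s where s: "s \<in> carrier_vec (m * d)" "v = ctrb d ?A ?B *\<^sub>v s" by blast
    obtain w where w: "\<And>i. w i \<in> carrier_vec m" "stack_past m d w d = s"
      using stack_past_surj[OF s(1)] by blast
    \<comment> \<open>The prescribed input \<open>w\<close> is preceded by \<open>N\<close> steps of
      rest, so that the lifted state is zero when \<open>w\<close> begins.\<close>
    define u where "u = (\<lambda>t. if t < N then 0\<^sub>v m else w (t - N))"
    have "u t \<in> carrier_vec m" for t using w by (simp add: u_def)
    then obtain x y where tr: "trajectory A B C u x y" "x 0 = 0\<^sub>v n"
      using trajectory_exists[OF A B, of "0\<^sub>v n" u C] by auto
    have "xi m p N u y (d + N) = ctrb d ?A ?B *\<^sub>v stack_past m d (\<lambda>t. u (t + N)) d"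
      by (rule lifted_reach[OF K tr]) (simp add: u_def)
    also have "(\<lambda>t. u (t + N)) = w" by (auto simp: u_def)
    finally have "v = xi m p N u y (d + N)" using s w by simp
    thus "v \<in> io_windows" using xi_in_io_windows[OF tr(1)] by simp
  next
    fix v assume "v \<in> io_windows"
    then obtain U z where U: "U \<in> carrier_vec (m * N)" and z: "z \<in> carrier_vec n"
      and v: "v = U @\<^sub>v (obsv N A C *\<^sub>v z + toep N A B C *\<^sub>v U)"
      unfolding io_windows_def by blast
    obtain a where a: "\<And>i. a i \<in> carrier_vec m" "z = ctrb n A B *\<^sub>v stack_past m n a n"
      using controllable_state[OF z] by blast
    obtain b where b: "\<And>i. b i \<in> carrier_vec m" "stack_past m N b N = U"
      using stack_past_surj[OF U] by blast
    \<comment> \<open>Rest until \<open>d - n\<close>, steer to \<open>z\<close> by time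
      \<open>d\<close>, then apply \<open>U\<close> until \<open>d + N\<close>. The lifted clock
      starts at \<open>N\<close>, so this end is its step \<open>d\<close>; by \<open>dge\<close>
      the rest lasts at least \<open>N\<close> steps.\<close>
    define u where "u = (\<lambda>t. if t < d - n then 0\<^sub>v m else if t < d then a (t - (d - n)) else b (t - d))"
    have "u t \<in> carrier_vec m" for t using a b by (simp add: u_def)
    then obtain x y where tr: "trajectory A B C u x y" "x 0 = 0\<^sub>v n"
      using trajectory_exists[OF A B, of "0\<^sub>v n" u C] by auto
    have u0: "u t = 0\<^sub>v m" if "t < d - n" for t using that by (simp add: u_def)
    have "x (d - n) = 0\<^sub>v n" using trajectory_rest[OF tr(1) A B tr(2) u0, of "d - n" "d - n"] by simp
    hence "x d = A ^\<^sub>m n *\<^sub>v 0\<^sub>v n + ctrb n A B *\<^sub>v stack_past m n u d"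
      using trajectory_state[OF tr(1) A B, of "d - n" n] dge by simp
    also have "stack_past m n u d = stack_past m n a n"
    proof (rule eq_vecI)
      fix i assume "i < dim_vec (stack_past m n a n)"
      hence i: "i < m * n" by simp
      hence "i div m < n" by (simp add: less_mult_imp_div_less mult.commute)
      hence "\<not> d - n + i div m < d - n" "d - n + i div m < d" using dge by linarith+
      hence "u (d - n + i div m) = a (i div m)" unfolding u_def by simp
      thus "stack_past m n u d $ i = stack_past m n a n $ i" using i by (simp add: stack_past_def)
    qed simp
    also have "A ^\<^sub>m n *\<^sub>v 0\<^sub>v n = 0\<^sub>v n"
      by (rule mult_mat_vec_zero[OF pow_carrier_mat[OF A]])
    finally have xd: "x d = z" using a(2) z by simp
    have "stack_past m N u (d + N) = stack_past m N b N"
      by (intro eq_vecI) (auto simp: stack_past_def u_def)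
    hence "v = xi m p N u y (d + N)" unfolding xi_eq_window[OF tr(1)] xd v using b by simp
    also have "\<dots> = ctrb d ?A ?B *\<^sub>v stack_past m d (\<lambda>t. u (t + N)) d"
      by (rule lifted_reach[OF K tr]) (rule u0, use dge in linarith)
    finally show "v \<in> (\<lambda>v. ctrb d ?A ?B *\<^sub>v v) ` carrier_vec (m * d)" by auto
  qed
qed

lemma rank_ctrb_lifted:
  assumes K: "reads_state K"
  shows "mat_rank (ctrb_mat (Omega_mat m p N + Gamma_mat m p N * C * K) (Bm_mat m p N)) = m * N + n"
proof -
  let ?A = "Omega_mat m p N + Gamma_mat m p N * C * K" and ?B = "Bm_mat m p N"
  have Kc: "K \<in> carrier_mat n d" using K by (simp add: reads_state_def)
  note lc = lifted_carrier[OF Kc]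
  have cc: "ctrb_mat ?A ?B \<in> carrier_mat d (m * d)"
    unfolding ctrb_mat_def carrier_matD(1)[OF lc(1)] by (rule ctrb_carrier[OF lc])
  obtain F where F: "F \<in> carrier_mat d (m * N + n)" "mat_image F = io_windows" "mat_rank F = m * N + n"
    using io_windows_eq_image by blast
  show ?thesis using mat_rank_eqI_image[OF cc F(1)] F image_ctrb_lifted[OF K] by simp
qed

text \<open>Every state has a predecessor even for singular \<open>A\<close>: controllability steers
  zero to \<open>x 0\<close> in \<open>n\<close> steps, and the last of these steps supplies a
  previous state and input. Repeating this manufactures the past that a window at time 0
  needs.\<close>

lemma trajectory_prepend:
  assumes tr: "trajectory A B C u x y"
  shows "\<exists>u' x' y'. trajectory A B C u' x' y' \<and> (\<forall>t. u' (t + k) = u t \<and> y' (t + k) = y t)"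
  using tr
proof (induction k arbitrary: u x y)
  case 0
  then show ?case by auto
next
  case (Suc k)
  note tr = Suc.prems
  have x0: "x 0 \<in> carrier_vec n" using trajectoryD[OF tr A B] by blast
  then obtain w where w: "\<And>i. w i \<in> carrier_vec m" "x 0 = ctrb n A B *\<^sub>v stack_past m n w n"
    using controllable_state by blast
  obtain z y0 where z: "trajectory A B C w z y0" "z 0 = 0\<^sub>v n"
    using trajectory_exists[OF A B, of "0\<^sub>v n" w C] w by auto
  have "x 0 = z n"
    using trajectory_state[OF z(1) A B, of 0 n] z(2) w(2) x0
      mult_mat_vec_zero[OF pow_carrier_mat[OF A, of n]] by simp
  \<comment> \<open>Since \<open>n\<close> is positive the steering has a last step, and
    \<open>z n'\<close> is the wanted predecessor.\<close>
  also obtain n' where "n = Suc n'" using n_pos by (cases n) auto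
  ultimately have x0_eq: "x 0 = A *\<^sub>v z n' + B *\<^sub>v w n'" using trajectoryD(3)[OF z(1) A B] by simp
  define u1 where "u1 = case_nat (w n') u"
  define x1 where "x1 = case_nat (z n') x"
  define y1 where "y1 = case_nat (C *\<^sub>v z n') y"
  have "trajectory A B C u1 x1 y1"
    unfolding trajectory_def
  proof (intro allI conjI)
    fix t
    show "u1 t \<in> carrier_vec (dim_col B)"
      using w(1) trajectoryD(1)[OF tr A B] B by (cases t) (auto simp: u1_def)
    show "x1 t \<in> carrier_vec (dim_row A)"
      using trajectoryD(2)[OF z(1) A B] trajectoryD(2)[OF tr A B] A by (cases t) (auto simp: x1_def)
    show "x1 (Suc t) = A *\<^sub>v x1 t + B *\<^sub>v u1 t"
      using x0_eq trajectoryD(3)[OF tr A B] by (cases t) (auto simp: x1_def u1_def)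
    show "y1 t = C *\<^sub>v x1 t"
      using trajectoryD(4)[OF tr A B] by (cases t) (auto simp: x1_def y1_def)
  qed
  from Suc.IH[OF this] obtain u' x' y' where IH: "trajectory A B C u' x' y'"
    "\<And>t. u' (t + k) = u1 t \<and> y' (t + k) = y1 t" by blast
  have "u' (t + Suc k) = u t \<and> y' (t + Suc k) = y t" for t
    using IH(2)[of "Suc t"] by (simp add: u1_def y1_def)
  with IH(1) show ?case by blast
qed

text \<open>After \<open>N\<close> steps of artificial past have been prepended, the delay by
  \<open>N\<close> in \<open>lifted_trajectory\<close> cancels and the original input and output
  appear from time 0.\<close>

lemma lifted_consistent:
  assumes K: "reads_state K"
  shows "consistent_with (Omega_mat m p N + Gamma_mat m p N * C * K) (Bm_mat m p N) (C * K) A B C"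
  unfolding consistent_with_def
proof (intro allI impI)
  fix u x y assume "trajectory A B C u x y"
  from trajectory_prepend[OF this, of N] obtain u' x' y' where
    tr: "trajectory A B C u' x' y'" "\<And>t. u' (t + N) = u t" "\<And>t. y' (t + N) = y t" by blast
  from lifted_trajectory[OF K tr(1)]
  show "\<exists>v. trajectory (Omega_mat m p N + Gamma_mat m p N * C * K) (Bm_mat m p N) (C * K) u v y"
    unfolding tr by blast
qed

lemma reads_state_add:
  assumes "M0 \<in> carrier_mat n d" "io_windows \<subseteq> mat_kernel M0"
  shows "reads_state (M_mat N A B C + M0)"
  unfolding reads_state_def
proof (intro conjI allI impI)
  show "M_mat N A B C + M0 \<in> carrier_mat n d" using assms(1) by simp
  fix u x y t assume tr: "trajectory A B C u x y" and "N \<le> t"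
  then obtain s where t: "t = s + N" using le_Suc_ex by (metis add.commute)
  have "M0 *\<^sub>v xi m p N u y t = 0\<^sub>v n"
    using xi_in_io_windows[OF tr, of s] assms mat_kernelD(2)[OF assms(1)] t by blast
  moreover have "M_mat N A B C *\<^sub>v xi m p N u y t = x t"
    using M_mat_reads_state tr \<open>N \<le> t\<close> by (simp add: reads_state_def)
  moreover have "x t \<in> carrier_vec n" using trajectoryD[OF tr A B] by blast
  ultimately show "(M_mat N A B C + M0) *\<^sub>v xi m p N u y t = x t"
    using add_mult_distrib_mat_vec[OF M_mat_carrier assms(1), of "xi m p N u y t"] by simp
qed

end

section \<open>The observability index and longer windows\<close>

lemma obsv_full_column_rank_mono:
  assumes A: "A \<in> carrier_mat n n" and C: "C \<in> carrier_mat p n"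
    and rk: "mat_rank (obsv k A C) = n" and "k \<le> N"
  shows "mat_rank (obsv N A C) = n"
  unfolding mat_rank_eq_dim_col_iff[OF obsv_carrier[OF A C]]
proof (intro ballI impI)
  fix v :: "real vec" assume v: "v \<in> carrier_vec n" and 0: "obsv N A C *\<^sub>v v = 0\<^sub>v (p * N)"
  \<comment> \<open>The rows of \<open>obsv k A C\<close> are the first \<open>p * k\<close> rows of
    \<open>obsv N A C\<close>, so the kernel can only shrink as the horizon grows.\<close>
  have "obsv k A C *\<^sub>v v = 0\<^sub>v (p * k)"
  proof (rule eq_vecI)
    fix r assume "r < dim_vec (0\<^sub>v (p * k) :: real vec)"
    hence r: "r < p * k" by simp
    hence r': "r < p * N" using \<open>k \<le> N\<close> by (meson less_le_trans mult_le_mono2)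
    have "(obsv k A C *\<^sub>v v) $ r = (obsv N A C *\<^sub>v v) $ r"
      unfolding obsv_mult_vec_index[OF A C v r] obsv_mult_vec_index[OF A C v r'] ..
    thus "(obsv k A C *\<^sub>v v) $ r = 0\<^sub>v (p * k) $ r" using 0 r r' by simp
  qed (use obsv_carrier[OF A C, of k] in simp)
  thus "v = 0\<^sub>v n" using mat_rank_eq_dim_col_iff[OF obsv_carrier[OF A C, of k]] rk v by blast
qed

lemma obsv_index_props:
  assumes A: "A \<in> carrier_mat n n" and C: "C \<in> carrier_mat p n" and "observable A C" "0 < n"
  shows "0 < obsv_index A C" "mat_rank (obsv (obsv_index A C) A C) = n" "obsv_index A C \<le> n"
proof -
  \<comment> \<open>\<open>observable\<close> tests the horizon \<open>n\<close>, which is therefore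
    a candidate for the least element.\<close>
  have n: "0 < n \<and> mat_rank (obsv n A C) = dim_row A"
    using assms by (simp add: observable_def)
  from LeastI[of "\<lambda>N. 0 < N \<and> mat_rank (obsv N A C) = dim_row A", OF n]
    Least_le[of "\<lambda>N. 0 < N \<and> mat_rank (obsv N A C) = dim_row A", OF n]
  show "0 < obsv_index A C" "mat_rank (obsv (obsv_index A C) A C) = n" "obsv_index A C \<le> n"
    using A unfolding obsv_index_def by auto
qed

section \<open>A setting with nonzero \<open>M\<^sub>0\<close>\<close>

lemma mat_rank_one: "mat_rank (1\<^sub>m k) = k"
  unfolding mat_rank_eq_dim_col_iff[OF one_carrier_mat] by simp

text \<open>Evaluates the square root, a definite description, for the example below: a nonnegative
  number with square 1 is 1.\<close>

lemma psd_sqrt_one: "psd_sqrt (1\<^sub>m 1) = 1\<^sub>m 1"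
proof -
  have psd: "psd_mat (1\<^sub>m 1)"
    by (auto simp: psd_mat_def scalar_prod_def)
  show ?thesis unfolding psd_sqrt_def
  proof (rule the_equality)
    show "psd_mat (1\<^sub>m 1) \<and> 1\<^sub>m 1 * 1\<^sub>m 1 = (1\<^sub>m 1 :: real mat)" using psd by simp
    fix S assume S: "psd_mat S \<and> S * S = 1\<^sub>m 1"
    hence "dim_row (S * S) = 1" by simp
    hence "dim_row S = 1" by simp
    hence Sc: "S \<in> carrier_mat 1 1" using S by (intro carrier_matI) (simp_all add: psd_mat_def)
    have "\<forall>v \<in> carrier_vec (dim_row S). 0 \<le> v \<bullet> (S *\<^sub>v v)" using S by (simp add: psd_mat_def)
    hence "0 \<le> unit_vec 1 0 \<bullet> (S *\<^sub>v unit_vec 1 0)" using Sc by (metis unit_vec_carrier carrier_matD(1))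
    hence nn: "0 \<le> S $$ (0, 0)" using Sc by (simp add: scalar_prod_def)
    have "(S * S) $$ (0, 0) = (1 :: real)" using S by simp
    hence "S $$ (0, 0) * S $$ (0, 0) = 1" using Sc by (simp add: scalar_prod_def)
    hence "S $$ (0, 0) = 1" using nn by (metis abs_of_nonneg abs_1 power2_eq_square power2_eq_1_iff abs_minus_cancel)
    thus "S = 1\<^sub>m 1" using Sc by (intro eq_matI) auto
  qed
qed

text \<open>The one-step delay \<open>x\<^sub>t\<^sub>+\<^sub>1 = u\<^sub>t\<close>, \<open>y\<^sub>t = x\<^sub>t\<close> observed through a window of length 2: its windows
  \<open>(u\<^sub>0, u\<^sub>1, y\<^sub>0, y\<^sub>1)\<close> are cut out by the single equation \<open>u\<^sub>0 - y\<^sub>1 = 0\<close>.\<close>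

lemma io_setting_nonzero_M0_exists:
  "\<exists>n m p N A B C Q M0. io_setting n m p N A B C Q M0 \<and> M0 \<noteq> 0\<^sub>m n ((m + p) * N)"
proof -
  define A :: "real mat" where "A = 0\<^sub>m 1 1"
  define I :: "real mat" where "I = 1\<^sub>m 1"
  \<comment> \<open>The row \<open>(1, 0, 0, -1)\<close> is the functional \<open>u0 - y1\<close> on
    vectors \<open>(u0, u1, y0, y1)\<close>. The matrix \<open>I\<close> serves as \<open>B\<close>,
    \<open>C\<close> and \<open>Q\<close> at once.\<close>
  define M0 :: "real mat" where
    "M0 = mat 1 4 (\<lambda>(i, j). if j = 0 then 1 else if j = 3 then - 1 else 0)"
  have A: "A \<in> carrier_mat 1 1" and I: "I \<in> carrier_mat 1 1" by (simp_all add: A_def I_def)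
  have M0: "M0 \<in> carrier_mat 1 4" by (simp add: M0_def)
  have "ctrb_mat A I = I"
    by (intro eq_matI) (auto simp: ctrb_mat_def ctrb_def A_def I_def)
  hence ctrl: "controllable A I" using mat_rank_one[of 1] by (simp add: controllable_def A_def I_def)
  have "obsv 1 A I = I"
    by (intro eq_matI) (auto simp: obsv_def A_def I_def)
  hence obsI: "observable A I" using mat_rank_one[of 1] by (simp add: observable_def A_def I_def)
  have "obsv_index A I \<le> 1" using obsv_index_props(3)[OF A I obsI] by simp
  have "mat_rank (obsv 2 A I) = 1"
    using obsv_full_column_rank_mono[OF A I, of 1 2] obsI by (simp add: observable_def A_def)
  \<comment> \<open>Interpreting the locale before \<open>io_setting\<close> is established gives
    access to \<open>image_ctrb_lifted\<close>, so only the windows have to be computed and not the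
    controllability matrix.\<close>
  then interpret io_system 1 1 1 2 A I I
    using A I ctrl by unfold_locales auto
  have O: "obsv 2 A I = mat 2 1 (\<lambda>(i, j). if i = 0 then 1 else 0)"
    by (intro eq_matI) (auto simp: obsv_def A_def I_def less_2_cases_iff scalar_prod_def)
  have T: "toep 2 A I I = mat 2 2 (\<lambda>(i, j). if i = 1 \<and> j = 0 then 1 else 0)"
    by (intro eq_matI) (auto simp: toep_def A_def I_def less_2_cases_iff scalar_prod_def)
  have M0v: "M0 *\<^sub>v v = 0\<^sub>v 1 \<longleftrightarrow> v $ 0 = v $ 3" if "v \<in> carrier_vec 4" for v :: "real vec"
    using that by (auto simp: vec_eq_iff M0_def scalar_prod_def numeral_eq_Suc)
  \<comment> \<open>The initial state is seen in \<open>y0\<close> only; \<open>y1\<close> repeats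
    \<open>u0\<close> because of the one-step delay.\<close>
  have window: "U @\<^sub>v (obsv 2 A I *\<^sub>v x + toep 2 A I I *\<^sub>v U)
      = vec 4 (\<lambda>i. [U $ 0, U $ 1, x $ 0, U $ 0] ! i)"
    if "U \<in> carrier_vec 2" "x \<in> carrier_vec 1" for U x :: "real vec"
    using that unfolding O T
    by (intro eq_vecI) (auto simp: scalar_prod_def numeral_eq_Suc less_Suc_eq)
  have "mat_kernel M0 = io_windows"
  proof (intro equalityI subsetI)
    fix v assume "v \<in> mat_kernel M0"
    hence v: "v \<in> carrier_vec 4" "v $ 0 = v $ 3" using mat_kernelD[OF M0] M0v by auto
    let ?U = "vec 2 (\<lambda>i. v $ i)" and ?x = "vec 1 (\<lambda>i. v $ 2)"
    have "v = vec 4 (\<lambda>i. [?U $ 0, ?U $ 1, ?x $ 0, ?U $ 0] ! i)"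
      using v by (intro eq_vecI) (auto simp: numeral_eq_Suc less_Suc_eq)
    hence "v = ?U @\<^sub>v (obsv 2 A I *\<^sub>v ?x + toep 2 A I I *\<^sub>v ?U)" using window[of ?U ?x] by simp
    moreover have "?U \<in> carrier_vec (1 * 2)" "?x \<in> carrier_vec 1" by auto
    ultimately show "v \<in> io_windows" unfolding io_windows_def by blast
  next
    fix v assume "v \<in> io_windows"
    then obtain U x where "U \<in> carrier_vec 2" "x \<in> carrier_vec 1"
      "v = U @\<^sub>v (obsv 2 A I *\<^sub>v x + toep 2 A I I *\<^sub>v U)" unfolding io_windows_def by auto
    hence v: "v = vec 4 (\<lambda>i. [U $ 0, U $ 1, x $ 0, U $ 0] ! i)" using window by simp
    show "v \<in> mat_kernel M0"
      by (rule mat_kernelI[OF M0]) (use M0v[of v] in \<open>auto simp: v numeral_eq_Suc\<close>)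
  qed
  hence ker: "mat_kernel M0 = mat_image (ctrb_mat
      (Omega_mat 1 1 2 + Gamma_mat 1 1 2 * I * M_mat 2 A I I) (Bm_mat 1 1 2))"
    using image_ctrb_lifted[OF M_mat_reads_state] by simp
  have "psd_sqrt (transpose_mat I * I * I) = I" using psd_sqrt_one by (simp add: I_def)
  moreover have "psd_mat I" by (auto simp: psd_mat_def scalar_prod_def I_def)
  moreover have "mat_rank I = 1" using mat_rank_one[of 1] by (simp add: I_def)
  ultimately have "io_setting 1 1 1 2 A I I I M0"
    using A I ctrl obsI \<open>obsv_index A I \<le> 1\<close> M0 ker by (simp add: io_setting_def)
  moreover have "M0 $$ (0, 0) \<noteq> 0\<^sub>m 1 ((1 + 1) * 2) $$ (0, 0)" by (simp add: M0_def)
  hence "M0 \<noteq> 0\<^sub>m 1 ((1 + 1) * 2)" by metis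
  ultimately show ?thesis by blast
qed

text \<open>That \<open>M0\<close> may be nonzero is stated as existence of a setting, since
  \<open>p * N = n\<close> forces \<open>M0\<close> to vanish. The clause for \<open>p = 1\<close>
  carries \<open>N = obsv_index A C\<close>: there the index equals \<open>n\<close>, and for larger
  \<open>N\<close> the rank \<open>m * N + n\<close> falls short of the dimension
  \<open>m * N + N\<close>.\<close>

theorem lemma3p4:
  fixes n m p N :: nat and A B C Q M0 :: "real mat"
  assumes "io_setting n m p N A B C Q M0"
  defines "M \<equiv> M_mat N A B C"
    and "Am \<equiv> Am_mat N A B C M0"
    and "Bm \<equiv> Bm_mat m p N"
  shows
    "(\<forall>u x y. trajectory A B C u x y \<longrightarrow>
        (\<forall>t\<ge>N. x t = (M + M0) *\<^sub>v xi m p N u y t)) \<and>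
     (\<exists>n' m' p' N' A' B' C' Q' M0'.
        io_setting n' m' p' N' A' B' C' Q' M0' \<and> M0' \<noteq> 0\<^sub>m n' ((m' + p') * N')) \<and>
     consistent_with Am Bm (C * (M + M0)) A B C \<and>
     mat_rank (ctrb_mat Am Bm) = m * N + n \<and>
     (controllable Am Bm \<longleftrightarrow>
        (p = 1 \<and> N = obsv_index A C) \<or> (p > 1 \<and> p * N = n))"
proof -
  have pos: "0 < n" "0 < m" "0 < p" and A: "A \<in> carrier_mat n n" and B: "B \<in> carrier_mat n m"
    and C: "C \<in> carrier_mat p n" and ctrl: "controllable A B" and obs: "observable A C"
    and idx: "obsv_index A C \<le> N" and M0: "M0 \<in> carrier_mat n ((m + p) * N)"
    and ker: "mat_kernel M0 = mat_image (ctrb_mat (Omega_mat m p N + Gamma_mat m p N * C * M) Bm)"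
    using assms(1) unfolding io_setting_def M_def Bm_def by auto
  note index = obsv_index_props[OF A C obs pos(1)]
  interpret io_system n m p N A B C
    using pos A B C ctrl index(1) idx obsv_full_column_rank_mono[OF A C index(2) idx]
    by unfold_locales auto
  have M0: "M0 \<in> carrier_mat n d" using M0 by (simp add: add_mult_distrib)
  have reads: "reads_state (M + M0)"
    unfolding M_def by (rule reads_state_add[OF M0])
      (use ker image_ctrb_lifted[OF M_mat_reads_state] in \<open>simp add: M_def Bm_def\<close>)
  have Am: "Am = Omega_mat m p N + Gamma_mat m p N * C * (M + M0)"
    using B C by (simp add: Am_def Am_mat_def M_def)
  have rank: "mat_rank (ctrb_mat Am Bm) = m * N + n"
    using rank_ctrb_lifted[OF reads] by (simp add: Am Bm_def)
  have "dim_row Am = d"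
    using lifted_carrier(1)[of "M + M0"] reads unfolding Am reads_state_def by auto
  hence "controllable Am Bm \<longleftrightarrow> p * N = n" using rank by (auto simp: controllable_def)
  \<comment> \<open>With a single output the observability matrix at the index has as many rows as
    the index, so rank \<open>n\<close> forces the index to be at least \<open>n\<close>; the other
    inequality is the third of the \<open>index\<close> facts.\<close>
  moreover have "obsv_index A C = n" if "p = 1"
    using mat_rank_le_dim_row[of "obsv (obsv_index A C) A C"] index that
      obsv_carrier[OF A C, of "obsv_index A C"] by simp
  ultimately have "controllable Am Bm \<longleftrightarrow>
      (p = 1 \<and> N = obsv_index A C) \<or> (p > 1 \<and> p * N = n)"
    using pos(3) by (cases "p = 1") auto
  moreover have "\<forall>u x y. trajectory A B C u x y \<longrightarrow> (\<forall>t\<ge>N. x t = (M + M0) *\<^sub>v xi m p N u y t)"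
    using reads by (simp add: reads_state_def)
  moreover have "consistent_with Am Bm (C * (M + M0)) A B C"
    using lifted_consistent[OF reads] by (simp add: Am Bm_def)
  ultimately show ?thesis using rank io_setting_nonzero_M0_exists by blast
qed

end
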